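(* Let $A\in\mathbb{H}^{n\times n}$ satisfy $\operatorname{rk}A^{2}=\operatorname{rk}A=s$ and $A^{\dagger}A\neq AA^{\dagger}$. Then the right core inverse $X=(x_{ij})$ of $A$ has, for all $i,j\in\{1,\dots,n\}$, the determinantal representation $$x_{ij}=\frac{\sum_{\alpha\in I_{s,n}\{j\}}\operatorname{rdet}_{j}\left((AA^{*})_{j.}(\tilde u_{i.})\right)_{\alpha}^{\alpha}}{\left(\sum_{\alpha\in I_{s,n}}\left|A^{3}(A^{3})^{*}\right|_{\alpha}^{\alpha}\right)\left(\sum_{\alpha\in I_{s,n}}\left|AA^{*}\right|_{\alpha}^{\alpha}\right)},$$ where $\tilde u_{i.}$ is the $i$th row of $\tilde U:=UA^{2}A^{*}$, and $U=(u_{if})\in\mathbb{H}^{n\times n}$ is the matrix with $$u_{if}=\sum_{\alpha\in I_{s,n}\{f\}}\operatorname{rdet}_{f}\left(\left(A^{3}(A^{3})^{*}\right)_{f.}(\check a_{i.})\right)_{\alpha}^{\alpha},$$ where $\check a_{i.}$ is the $i$th row of $\check A=A(A^{3})^{*}$.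
   Context: $\mathbb{H}$ is the skew field of real quaternions, $A^{*}$ is the conjugate transpose, and $\operatorname{rk}A$ is the rank of $A$ (dimension of the right column space, equal to the dimension of the left row space). The Moore-Penrose inverse $A^{\dagger}$ is the unique $X$ with $AXA=A$, $XAX=X$, $(AX)^{*}=AX$, $(XA)^{*}=XA$. Let $\mathcal{R}_r(A)=\{Ax: x\in\mathbb{H}^{n\times 1}\}$ be the right column space of $A\in\mathbb{H}^{n\times n}$. The right core inverse of $A$ is the matrix $X\in\mathbb{H}^{n\times n}$ with $AX=AA^{\dagger}$ and $\mathcal{R}_r(X)=\mathcal{R}_r(A)$; it exists if and only if $\operatorname{rk}A^{2}=\operatorname{rk}A$. Row determinant: let $M=(m_{pq})$ be a square quaternion matrix of size $N$ whose rows and columns are both labelled by a set $\alpha$ of $N$ integers, and let $i\in\alpha$. Then $$\operatorname{rdet}_iM=\sum_{\sigma}(-1)^{N-r}\left(m_{i\,i_{k_1}}m_{i_{k_1}i_{k_1+1}}\cdots m_{i_{k_1+l_1}i}\right)\cdots\left(m_{i_{k_r}i_{k_r+1}}\cdots m_{i_{k_r+l_r}i_{k_r}}\right),$$ the sum over all permutations $\sigma$ of $\alpha$, each written as a product of its $r$ disjoint cycles (fixed points included) $\sigma=(i\,i_{k_1}i_{k_1+1}\dots i_{k_1+l_1})(i_{k_2}i_{k_2+1}\dots i_{k_2+l_2})\cdots(i_{k_r}i_{k_r+1}\dots i_{k_r+l_r})$, where the first cycle starts with $i$, every other cycle starts with its smallest element, and $i_{k_2}<\dots<i_{k_r}$ (a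 fixed point $p$ contributes the factor $m_{pp}$). If $M$ is Hermitian, all $\operatorname{rdet}_iM$ coincide and are real; the common value is $\det M$. Index sets and submatrices: for $1\le k\le n$, $I_{k,n}$ is the set of all $k$-element subsets $\alpha=\{\alpha_1<\dots<\alpha_k\}$ of $\{1,\dots,n\}$, and $I_{k,n}\{j\}=\{\alpha\in I_{k,n}: j\in\alpha\}$. $M_\alpha^\alpha$ is the principal submatrix of $M$ with rows and columns indexed by $\alpha$ (labels kept); for Hermitian $M$, $|M|_\alpha^\alpha=\det(M_\alpha^\alpha)$. $M_{j.}(b)$ is obtained from $M$ by replacing its $j$th row by the row $b$. $\operatorname{rdet}_j(M_{j.}(b))_\alpha^\alpha$ means $\operatorname{rdet}_j$ (along the row labelled $j$) of the principal submatrix $(M_{j.}(b))_\alpha^\alpha$. *)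

theory Defs
  imports
    Complex_Main
    "HOL-Combinatorics.Cycles"
    "Jordan_Normal_Form.Matrix"
begin

section \<open>Real quaternions\<close>

text \<open>\<open>Quat a b c d\<close> is the quaternion $a + b i + c j + d k$.\<close>

datatype quat = Quat (qRe: real) (qIm1: real) (qIm2: real) (qIm3: real)

lemma quat_eq_iff:
  "x = y \<longleftrightarrow> qRe x = qRe y \<and> qIm1 x = qIm1 y \<and> qIm2 x = qIm2 y \<and> qIm3 x = qIm3 y"
  by (cases x; cases y) simp

instantiation quat :: real_div_algebra
begin

definition zero_quat :: quat where
  "0 = Quat 0 0 0 0"

definition one_quat :: quat where
  "1 = Quat 1 0 0 0"

definition plus_quat :: "quat \<Rightarrow> quat \<Rightarrow> quat" where
  "x + y = Quat (qRe x + qRe y) (qIm1 x + qIm1 y) (qIm2 x + qIm2 y) (qIm3 x + qIm3 y)"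

definition uminus_quat :: "quat \<Rightarrow> quat" where
  "- x = Quat (- qRe x) (- qIm1 x) (- qIm2 x) (- qIm3 x)"

definition minus_quat :: "quat \<Rightarrow> quat \<Rightarrow> quat" where
  "x - y = Quat (qRe x - qRe y) (qIm1 x - qIm1 y) (qIm2 x - qIm2 y) (qIm3 x - qIm3 y)"

definition times_quat :: "quat \<Rightarrow> quat \<Rightarrow> quat" where
  "x * y = Quat
     (qRe x * qRe y - qIm1 x * qIm1 y - qIm2 x * qIm2 y - qIm3 x * qIm3 y)
     (qRe x * qIm1 y + qIm1 x * qRe y + qIm2 x * qIm3 y - qIm3 x * qIm2 y)
     (qRe x * qIm2 y - qIm1 x * qIm3 y + qIm2 x * qRe y + qIm3 x * qIm1 y)
     (qRe x * qIm3 y + qIm1 x * qIm2 y - qIm2 x * qIm1 y + qIm3 x * qRe y)"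

definition scaleR_quat :: "real \<Rightarrow> quat \<Rightarrow> quat" where
  "r *\<^sub>R x = Quat (r * qRe x) (r * qIm1 x) (r * qIm2 x) (r * qIm3 x)"

definition inverse_quat :: "quat \<Rightarrow> quat" where
  "inverse x = (let d = (qRe x)\<^sup>2 + (qIm1 x)\<^sup>2 + (qIm2 x)\<^sup>2 + (qIm3 x)\<^sup>2
     in Quat (qRe x / d) (- qIm1 x / d) (- qIm2 x / d) (- qIm3 x / d))"

definition divide_quat :: "quat \<Rightarrow> quat \<Rightarrow> quat" where
  "x div y = x * inverse (y :: quat)"

instance
proof
  fix x :: quat
  assume "x \<noteq> 0"
  then have d: "(qRe x)\<^sup>2 + (qIm1 x)\<^sup>2 + (qIm2 x)\<^sup>2 + (qIm3 x)\<^sup>2 \<noteq> 0" (is "?d \<noteq> 0")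
    by (auto simp: quat_eq_iff zero_quat_def add_nonneg_eq_0_iff)
  have "(qRe x * qRe x + qIm1 x * qIm1 x + qIm2 x * qIm2 x + qIm3 x * qIm3 x) / ?d = 1"
    using d by (simp add: power2_eq_square)
  then have e: "qRe x * qRe x / ?d + qIm1 x * qIm1 x / ?d + qIm2 x * qIm2 x / ?d
      + qIm3 x * qIm3 x / ?d = 1"
    by (simp add: add_divide_distrib)
  show "inverse x * x = 1" "x * inverse x = 1"
    using e by (simp_all add: quat_eq_iff inverse_quat_def times_quat_def one_quat_def Let_def
        mult.commute)
qed (auto simp: quat_eq_iff zero_quat_def one_quat_def plus_quat_def uminus_quat_def
    minus_quat_def times_quat_def scaleR_quat_def inverse_quat_def divide_quat_def algebra_simps)

end

definition qcnj :: "quat \<Rightarrow> quat" where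
  "qcnj x = Quat (qRe x) (- qIm1 x) (- qIm2 x) (- qIm3 x)"


section \<open>Quaternion matrices\<close>

text \<open>Rows and columns are numbered \<open>0, \<dots>, n - 1\<close>, as is usual for the type of matrices used here.
  The product \<open>A *\<^sub>v x\<close> puts the entries of \<open>A\<close> to the left of those of \<open>x\<close>, so it is linear for
  scalars acting on \<open>x\<close> from the right.\<close>

definition conj_transpose :: "quat mat \<Rightarrow> quat mat" where
  "conj_transpose A = map_mat qcnj (transpose_mat A)"

definition right_col_space :: "quat mat \<Rightarrow> quat vec set" where
  "right_col_space A = {A *\<^sub>v x | x. x \<in> carrier_vec (dim_col A)}"

text \<open>Right linear combinations of a list of vectors of length \<open>m\<close> are the products
  \<open>mat_of_cols m bs *\<^sub>v c\<close>, where \<open>c\<close> is the vector of the (right) coefficients.\<close>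

definition right_basis :: "nat \<Rightarrow> quat vec set \<Rightarrow> quat vec list \<Rightarrow> bool" where
  "right_basis m V bs \<longleftrightarrow> set bs \<subseteq> carrier_vec m
     \<and> (\<forall>c \<in> carrier_vec (length bs).
           mat_of_cols m bs *\<^sub>v c = 0\<^sub>v m \<longrightarrow> c = 0\<^sub>v (length bs))
     \<and> {mat_of_cols m bs *\<^sub>v c | c. c \<in> carrier_vec (length bs)} = V"

definition right_dim :: "nat \<Rightarrow> quat vec set \<Rightarrow> nat" where
  "right_dim m V = (THE k. \<exists>bs. right_basis m V bs \<and> length bs = k)"

definition quat_rank :: "quat mat \<Rightarrow> nat" where
  "quat_rank A = right_dim (dim_row A) (right_col_space A)"

definition is_moore_penrose :: "quat mat \<Rightarrow> quat mat \<Rightarrow> bool" where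
  "is_moore_penrose A X \<longleftrightarrow> X \<in> carrier_mat (dim_col A) (dim_row A)
     \<and> A * X * A = A \<and> X * A * X = X
     \<and> conj_transpose (A * X) = A * X \<and> conj_transpose (X * A) = X * A"

definition moore_penrose :: "quat mat \<Rightarrow> quat mat" where
  "moore_penrose A = (THE X. is_moore_penrose A X)"

definition is_right_core_inverse :: "quat mat \<Rightarrow> quat mat \<Rightarrow> bool" where
  "is_right_core_inverse A X \<longleftrightarrow> X \<in> carrier_mat (dim_row A) (dim_row A)
     \<and> A * X = A * moore_penrose A \<and> right_col_space X = right_col_space A"

definition right_core_inverse :: "quat mat \<Rightarrow> quat mat" where
  "right_core_inverse A = (THE X. is_right_core_inverse A X)"


section \<open>Row determinants\<close>

text \<open>A principal submatrix keeps its labels, so it is represented by the full matrix \<open>M\<close> together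
  with the set \<open>\<alpha>\<close> of selected indices.

  \<open>support \<sigma> p\<close> is the list \<open>[p, \<sigma> p, \<sigma> (\<sigma> p), \<dots>]\<close> running once through the cycle
  of \<open>p\<close> (the list \<open>[p]\<close> for a fixed point), hence \<open>cycle_factor M \<sigma> p\<close> is the ordered product
  of the entries of \<open>M\<close> along that cycle, starting in row \<open>p\<close>.\<close>

definition cycle_factor :: "quat mat \<Rightarrow> (nat \<Rightarrow> nat) \<Rightarrow> nat \<Rightarrow> quat" where
  "cycle_factor M \<sigma> p = prod_list (map (\<lambda>q. M $$ (q, \<sigma> q)) (support \<sigma> p))"

definition cycle_starts :: "nat set \<Rightarrow> nat \<Rightarrow> (nat \<Rightarrow> nat) \<Rightarrow> nat list" where
  "cycle_starts \<alpha> i \<sigma> =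
     i # sorted_list_of_set
       {p \<in> \<alpha>. p \<notin> set (support \<sigma> i) \<and> p = Min (set (support \<sigma> p))}"

definition rdet :: "nat set \<Rightarrow> nat \<Rightarrow> quat mat \<Rightarrow> quat" where
  "rdet \<alpha> i M = (\<Sum>\<sigma> | \<sigma> permutes \<alpha>.
     (-1) ^ (card \<alpha> - length (cycle_starts \<alpha> i \<sigma>))
       * prod_list (map (cycle_factor M \<sigma>) (cycle_starts \<alpha> i \<sigma>)))"

text \<open>The determinant of a Hermitian principal submatrix: the common real value of its row
  determinants (meaningful for nonempty \<open>\<alpha>\<close> and Hermitian \<open>M\<close> only).\<close>

definition herm_minor :: "quat mat \<Rightarrow> nat set \<Rightarrow> real" where
  "herm_minor M \<alpha> = (THE d. \<forall>i \<in> \<alpha>. rdet \<alpha> i M = of_real d)"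

definition index_sets :: "nat \<Rightarrow> nat \<Rightarrow> nat set set" where
  "index_sets k n = {\<alpha>. \<alpha> \<subseteq> {..<n} \<and> card \<alpha> = k}"

definition index_sets_at :: "nat \<Rightarrow> nat \<Rightarrow> nat \<Rightarrow> nat set set" where
  "index_sets_at k n j = {\<alpha> \<in> index_sets k n. j \<in> \<alpha>}"

definition replace_row :: "quat mat \<Rightarrow> nat \<Rightarrow> quat vec \<Rightarrow> quat mat" where
  "replace_row M j b =
     mat (dim_row M) (dim_col M) (\<lambda>(p, q). if p = j then b $ q else M $$ (p, q))"

end

theory Submission
  imports Defs
begin

text \<open>
  For an index-one matrix \<open>A\<close> the right core inverse is \<open>A (A\<^sup>3)\<^sup>\<dagger> A\<^sup>2 A\<^sup>\<dagger>\<close>, so it suffices to represent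
  Moore-Penrose inverses. Put \<open>H = A A\<^sup>*\<close>, let \<open>d s\<close> be the sum of its principal minors of order \<open>s\<close>,
  and let \<open>G s\<close> be the matrix with \<open>(b G s)\<^sub>j\<close> equal to the sum of
  \<open>rdet\<^sub>j (H\<^sub>j\<^sub>.(b))\<close> over the index sets of size \<open>s\<close> containing \<open>j\<close>. Sorting the terms of a row
  determinant by the cycle of \<open>j\<close> gives \<open>H G s + G (s + 1) = d s\<close>. Here the Hermitian symmetry enters: it
  makes the sum over a cycle and its reverse real, hence central and independent of the starting point. By
  this recursion \<open>G s\<close> is a polynomial in \<open>H\<close>, and the real trace of \<open>H G s\<close> is \<open>s d s\<close>. For the largest \<open>r\<close>
  with \<open>d r \<noteq> 0\<close> the matrix \<open>H G r / d r\<close> is the orthogonal projection onto the column space of \<open>A\<close>, so that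
  \<open>A\<^sup>\<dagger> = A\<^sup>* G r / d r\<close>; as the real trace of a projection is its rank, \<open>r\<close> is the rank of \<open>A\<close>.
\<close>

subsection \<open>Contracting a permutation\<close>

text \<open>Noncommutativity shapes the proof: a row determinant along \<open>j\<close> is left
  linear only in row \<open>j\<close>, so arguments by multilinearity and row exchanges break down.
  They are replaced by signed sums over paths: the order of the factors is the order of travel, and
  identities come from cutting paths and cycles apart. Hermitian symmetry enters where a closed path
  must be restarted elsewhere or moved past other factors. The vanishing of \<open>H G s\<close> for
  \<open>s > r\<close> is not read off from minors either; it follows from positivity,
  \<open>X X^* = 0\<close> only for \<open>X = 0\<close>, by descending from
  \<open>s = n + 1\<close>. Only the real part of the trace can serve as dimension count, because
  \<open>qRe (x * y) = qRe (y * x)\<close> while \<open>x * y\<close> and \<open>y * x\<close>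
  differ. Origin of the formula for the core inverse: if \<open>A\<close> has index one and
  \<open>A^3 K A^3 = A^3\<close>, then \<open>A K A\<close> is the group inverse of
  \<open>A\<close>, and the right core inverse is the group inverse times the orthogonal projection
  onto the column space of \<open>A\<close>.\<close>

lemma least_power_eqI:
  assumes "(f ^^ Suc n) x = x" "\<And>i. 0 < i \<Longrightarrow> i \<le> n \<Longrightarrow> (f ^^ i) x \<noteq> x"
  shows "least_power f x = Suc n"
  unfolding least_power_def
proof (rule Least_equality)
  show "(f ^^ Suc n) x = x \<and> 0 < Suc n" using assms(1) by simp
  fix k assume "(f ^^ k) x = x \<and> 0 < k"
  then show "Suc n \<le> k" using assms(2)[of k] by (meson not_less_eq_eq)
qed

lemma permutes_imp_permutation: "finite S \<Longrightarrow> p permutes S \<Longrightarrow> permutation p"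
  using permutation_permutes by blast

lemma start_in_support:
  assumes "permutation p" shows "x \<in> set (support p x)"
  using least_power_of_permutation(2)[OF assms, of x] by force

lemma support_subset:
  assumes "p permutes S" "x \<in> S" shows "set (support p x) \<subseteq> S"
  using permutes_in_image[OF permutes_funpow[OF assms(1)]] assms(2) by auto

lemma support_conv_Cons:
  assumes "permutation p"
  shows "support p x = x # map (\<lambda>i. (p ^^ i) x) [1..<least_power p x]"
  using least_power_of_permutation(2)[OF assms, of x] by (subst upt_conv_Cons) auto

lemma support_fixpoint: "f x = x \<Longrightarrow> support f x = [x]"
proof -
  assume "f x = x"
  then have "least_power f x = Suc 0" by (intro least_power_eqI) auto
  then show ?thesis by simp
qed

lemma support_same:
  assumes "permutation p" "y \<in> set (support p x)"
  shows "set (support p y) = set (support p x)"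
proof (rule ccontr)
  assume "set (support p y) \<noteq> set (support p x)"
  then have "set (support p y) \<inter> set (support p x) = {}"
    using disjoint_support[OF assms(1)] by (meson UNIV_I disjoint_def image_iff)
  then show False using start_in_support[OF assms(1), of y] assms(2) by auto
qed

text \<open>Under the composed map \<open>j\<close> goes to \<open>q\<close>, then \<open>q\<close>
  goes to \<open>p j\<close> because \<open>p\<close> fixes \<open>q\<close>, and from there the
  orbit follows \<open>p\<close> until it is back at \<open>j\<close>. Hence the iterates are
  delayed by one step.\<close>

lemma support_transpose:
  assumes "permutation p" "p q = q" "j \<noteq> q"
  shows "support (p \<circ> transpose j q) j = j # q # tl (support p j)"
proof -
  define t where "t = p \<circ> transpose j q"
  define L where "L = least_power p j"
  have L: "(p ^^ L) j = j" "0 < L"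
    using least_power_of_permutation[OF assms(1)] unfolding L_def by auto
  have Lmin: "(p ^^ i) j \<noteq> j" if "0 < i" "i < L" for i
    using least_power_le[of i p j] that unfolding L_def by auto
  have pq: "(p ^^ i) q = q" for i using assms(2) by (induct i) auto
  have nq: "(p ^^ i) j \<noteq> q" for i
  proof
    assume "(p ^^ i) j = q"
    then have "(p ^^ i) j = (p ^^ i) q" using pq by simp
    moreover have "inj (p ^^ i)"
      using assms(1) by (simp add: inj_fn permutation bij_is_inj)
    ultimately show False using assms(3) by (auto dest: injD)
  qed
  have it: "(t ^^ (i + 2)) j = (p ^^ (i + 1)) j" if "i < L" for i
    using that
  proof (induct i)
    case 0
    show ?case by (simp add: t_def assms(2,3) numeral_2_eq_2)
  next
    case (Suc i)
    then have "(t ^^ (Suc i + 2)) j = t ((p ^^ (i + 1)) j)" by simp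
    also have "\<dots> = p ((p ^^ (i + 1)) j)"
      using Lmin[of "i + 1"] Suc.prems nq[of "i + 1"] by (simp add: t_def transpose_def)
    finally show ?case by simp
  qed
  have t1: "t j = q" using assms by (simp add: t_def)
  have lt: "least_power t j = Suc L"
  proof (rule least_power_eqI)
    show "(t ^^ Suc L) j = j" using it[of "L - 1"] L by (cases L) (auto simp del: funpow.simps)
    fix i assume i: "0 < i" "i \<le> L"
    show "(t ^^ i) j \<noteq> j"
    proof (cases "i = 1")
      case True then show ?thesis using t1 assms(3) by simp
    next
      case False
      then obtain k where "i = k + 2" using i(1) by (metis One_nat_def Suc_eq_plus1 add_2_eq_Suc' gr0_conv_Suc not0_implies_Suc)
      then show ?thesis using it[of k] Lmin[of "k + 1"] i by simp
    qed
  qed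
  have "support t j = j # q # map (\<lambda>i. (p ^^ i) j) [1..<L]"
  proof (rule nth_equalityI)
    show "length (support t j) = length (j # q # map (\<lambda>i. (p ^^ i) j) [1..<L])"
      using L(2) lt by simp
    fix i assume "i < length (support t j)"
    then have i: "i < Suc L" using lt by simp
    then have l: "support t j ! i = (t ^^ i) j" using lt by (simp del: upt_Suc)
    consider "i = 0" | "i = 1" | k where "i = k + 2"
      by (metis One_nat_def Suc_eq_plus1 add_2_eq_Suc' not0_implies_Suc)
    then show "support t j ! i = (j # q # map (\<lambda>i. (p ^^ i) j) [1..<L]) ! i"
    proof cases
      case 3
      then have "[1..<L] ! k = k + 1" using i by (subst nth_upt) auto
      then show ?thesis using 3 i it[of k] unfolding l by simp
    qed (use l t1 in auto)
  qed
  then show ?thesis unfolding t_def[symmetric] support_conv_Cons[OF assms(1)] L_def by simp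
qed

text \<open>The transposition moves only \<open>j\<close> and \<open>q\<close>, and an orbit of
  \<open>p\<close> that starts off the cycle of \<open>j\<close> and not at \<open>q\<close> meets
  neither. The second part is there because a cycle product also reads the images of the
  elements.\<close>

lemma support_transpose_other:
  assumes "permutation p" "p q = q" "x \<notin> set (support p j)" "x \<noteq> q"
  shows "support (p \<circ> transpose j q) x = support p x"
    and "\<And>y. y \<in> set (support p x) \<Longrightarrow> y \<noteq> j \<and> y \<noteq> q \<and> (p \<circ> transpose j q) y = p y"
proof -
  have pq: "(p ^^ i) q = q" for i using assms(2) by (induct i) auto
  have nq: "(p ^^ i) x \<noteq> q" for i
  proof
    assume "(p ^^ i) x = q"
    then have "(p ^^ i) x = (p ^^ i) q" using pq by simp
    moreover have "inj (p ^^ i)"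
      using assms(1) by (simp add: inj_fn permutation bij_is_inj)
    ultimately show False using assms(4) by (auto dest: injD)
  qed
  have nj: "(p ^^ i) x \<noteq> j" for i
  proof
    assume "(p ^^ i) x = j"
    then have "j \<in> set (support p x)" unfolding support_set[OF assms(1)] by auto
    then show False using support_same[OF assms(1)] start_in_support[OF assms(1)] assms(3) by metis
  qed
  have it: "((p \<circ> transpose j q) ^^ i) x = (p ^^ i) x" for i
    using nq nj by (induct i) (simp_all add: transpose_def)
  show "support (p \<circ> transpose j q) x = support p x"
    unfolding least_power_def it ..
  show "y \<noteq> j \<and> y \<noteq> q \<and> (p \<circ> transpose j q) y = p y" if "y \<in> set (support p x)" for y
    using that nq nj by (auto simp: transpose_def)
qed

subsection \<open>Row determinants over a ring\<close>

text \<open>With entries given by a function, overwriting row \<open>j\<close> is the update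
  \<open>m(j := b)\<close>, and no dimensions have to be carried through the combinatorics.\<close>

definition cycle_prod :: "(nat \<Rightarrow> nat \<Rightarrow> 'a::ring_1) \<Rightarrow> (nat \<Rightarrow> nat) \<Rightarrow> nat \<Rightarrow> 'a" where
  "cycle_prod m \<sigma> p = prod_list (map (\<lambda>q. m q (\<sigma> q)) (support \<sigma> p))"

definition rowdet_term :: "nat set \<Rightarrow> nat \<Rightarrow> (nat \<Rightarrow> nat \<Rightarrow> 'a::ring_1) \<Rightarrow> (nat \<Rightarrow> nat) \<Rightarrow> 'a" where
  "rowdet_term \<alpha> i m \<sigma> = (-1) ^ (card \<alpha> - length (cycle_starts \<alpha> i \<sigma>))
     * prod_list (map (cycle_prod m \<sigma>) (cycle_starts \<alpha> i \<sigma>))"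

definition rowdet :: "nat set \<Rightarrow> nat \<Rightarrow> (nat \<Rightarrow> nat \<Rightarrow> 'a::ring_1) \<Rightarrow> 'a" where
  "rowdet \<alpha> i m = (\<Sum>\<sigma> | \<sigma> permutes \<alpha>. rowdet_term \<alpha> i m \<sigma>)"

lemma rdet_conv_rowdet: "rdet \<alpha> i M = rowdet \<alpha> i (\<lambda>p q. M $$ (p, q))"
proof -
  have "cycle_factor M = cycle_prod (\<lambda>p q. M $$ (p, q))"
    by (simp add: fun_eq_iff cycle_factor_def cycle_prod_def)
  then show ?thesis by (simp only: rdet_def rowdet_def rowdet_term_def)
qed

text \<open>Every cycle but the first starts with its smallest element, so after the first cycle has been
  split off, the rest of a term is a term of the row determinant along the smallest remaining row.\<close>

definition restdet :: "nat set \<Rightarrow> (nat \<Rightarrow> nat \<Rightarrow> 'a::ring_1) \<Rightarrow> 'a" where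
  "restdet \<beta> m = (if \<beta> = {} then 1 else rowdet \<beta> (Min \<beta>) m)"

lemma set_cycle_starts_subset: "finite \<alpha> \<Longrightarrow> i \<in> \<alpha> \<Longrightarrow> set (cycle_starts \<alpha> i \<sigma>) \<subseteq> \<alpha>"
  by (auto simp: cycle_starts_def)

text \<open>The sign exponent of a term is a truncated difference; this bound ensures that nothing
  is cut off when the exponents of two index sets are compared.\<close>

lemma length_cycle_starts_le:
  assumes "finite \<alpha>" "i \<in> \<alpha>" "\<sigma> permutes \<alpha>"
  shows "length (cycle_starts \<alpha> i \<sigma>) \<le> card \<alpha>"
proof -
  have "distinct (cycle_starts \<alpha> i \<sigma>)"
    using start_in_support[OF permutes_imp_permutation[OF assms(1,3)], of i] assms(1)
    by (auto simp: cycle_starts_def)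
  then show ?thesis
    using card_mono[OF assms(1) set_cycle_starts_subset[OF assms(1,2)]]
    by (metis distinct_card)
qed

lemma rowdet_cong:
  assumes "finite \<alpha>" "i \<in> \<alpha>" "\<And>p q. p \<in> \<alpha> \<Longrightarrow> q \<in> \<alpha> \<Longrightarrow> m p q = m' p q"
  shows "rowdet \<alpha> i m = rowdet \<alpha> i m'"
  unfolding rowdet_def
proof (rule sum.cong[OF refl])
  fix \<sigma> assume "\<sigma> \<in> {\<sigma>. \<sigma> permutes \<alpha>}"
  then have s: "\<sigma> permutes \<alpha>" by simp
  have c: "cycle_prod m \<sigma> p = cycle_prod m' \<sigma> p" if "p \<in> \<alpha>" for p
    unfolding cycle_prod_def
    using support_subset[OF s that] permutes_in_image[OF s] assms(3)
    by (intro arg_cong[where f = prod_list] map_cong[OF refl]) blast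
  have "map (cycle_prod m \<sigma>) (cycle_starts \<alpha> i \<sigma>) = map (cycle_prod m' \<sigma>) (cycle_starts \<alpha> i \<sigma>)"
    using c set_cycle_starts_subset[OF assms(1,2)] by (intro map_cong[OF refl]) blast
  then show "rowdet_term \<alpha> i m \<sigma> = rowdet_term \<alpha> i m' \<sigma>" by (simp only: rowdet_term_def)
qed

lemma restdet_cong:
  assumes "finite \<beta>" "\<And>p q. p \<in> \<beta> \<Longrightarrow> q \<in> \<beta> \<Longrightarrow> m p q = m' p q"
  shows "restdet \<beta> m = restdet \<beta> m'"
  using rowdet_cong[of \<beta> "Min \<beta>" m m'] assms by (simp add: restdet_def)

text \<open>Composing with \<open>transpose j q\<close> inserts \<open>q\<close> right after \<open>j\<close> into the cycle of \<open>j\<close>.\<close>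

lemma rowdet_term_transpose:
  assumes "finite \<alpha>" "j \<in> \<alpha>" "q \<in> \<alpha>" "j \<noteq> q" "\<sigma> permutes (\<alpha> - {q})"
  shows "rowdet_term \<alpha> j m (\<sigma> \<circ> transpose j q)
    = - (m j q * rowdet_term (\<alpha> - {q}) j (m(j := m q)) \<sigma>)"
proof -
  define \<tau> where "\<tau> = \<sigma> \<circ> transpose j q"
  have perm: "permutation \<sigma>" using permutes_imp_permutation[OF _ assms(5)] assms(1) by simp
  have fq: "\<sigma> q = q" using assms(5) by (simp add: permutes_def)
  have sj: "support \<tau> j = j # q # tl (support \<sigma> j)"
    unfolding \<tau>_def by (rule support_transpose[OF perm fq assms(4)])
  have sj0: "support \<sigma> j = j # tl (support \<sigma> j)" by (subst (1 2) support_conv_Cons[OF perm]) simp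
  have set_sj: "set (support \<tau> j) = insert q (set (support \<sigma> j))"
    unfolding sj by (subst (2) sj0) auto
  have so: "support \<tau> x = support \<sigma> x" if "x \<notin> set (support \<sigma> j)" "x \<noteq> q" for x
    unfolding \<tau>_def by (rule support_transpose_other(1)[OF perm fq that])
  have so2: "y \<noteq> j" "\<tau> y = \<sigma> y" if "x \<notin> set (support \<sigma> j)" "x \<noteq> q" "y \<in> set (support \<sigma> x)" for x y
    using support_transpose_other(2)[OF perm fq that(1,2,3)] unfolding \<tau>_def by auto
  let ?S = "{p \<in> \<alpha> - {q}. p \<notin> set (support \<sigma> j) \<and> p = Min (set (support \<sigma> p))}"
  have starts: "{p \<in> \<alpha>. p \<notin> set (support \<tau> j) \<and> p = Min (set (support \<tau> p))} = ?S"
  proof (rule Collect_cong)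
    fix p
    show "p \<in> \<alpha> \<and> p \<notin> set (support \<tau> j) \<and> p = Min (set (support \<tau> p)) \<longleftrightarrow>
      p \<in> \<alpha> - {q} \<and> p \<notin> set (support \<sigma> j) \<and> p = Min (set (support \<sigma> p))"
    proof (cases "p \<notin> set (support \<sigma> j) \<and> p \<noteq> q")
      case True
      then have "set (support \<tau> p) = set (support \<sigma> p)"
        by (intro arg_cong[where f = set] so) auto
      then show ?thesis using True unfolding set_sj by (metis Diff_iff insert_iff singletonD)
    next
      case False
      then show ?thesis unfolding set_sj by blast
    qed
  qed
  have cs: "cycle_starts \<alpha> j \<tau> = cycle_starts (\<alpha> - {q}) j \<sigma>"
    unfolding cycle_starts_def starts ..
  have co: "cycle_prod m \<tau> x = cycle_prod (m(j := m q)) \<sigma> x" if "x \<in> ?S" for x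
  proof -
    have x: "x \<notin> set (support \<sigma> j)" "x \<noteq> q" using that by auto
    show ?thesis unfolding cycle_prod_def so[OF x]
      by (intro arg_cong[where f = prod_list] map_cong[OF refl]) (use so2[OF x] in auto)
  qed
  have tj: "\<tau> j = q" "\<tau> q = \<sigma> j" using fq by (auto simp: \<tau>_def)
  have dist: "distinct (support \<sigma> j)" by (rule cycle_of_permutation[OF perm])
  have tlx: "m y (\<tau> y) = (m(j := m q)) y (\<sigma> y)" if "y \<in> set (tl (support \<sigma> j))" for y
  proof -
    have "y \<noteq> j" using that dist sj0 by (metis distinct.simps(2))
    moreover have "y \<in> \<alpha> - {q}"
    proof -
      have "y \<in> set (support \<sigma> j)" using that sj0 by (metis list.set_intros(2))
      then show ?thesis using support_subset[OF assms(5), of j] assms(2,4) by blast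
    qed
    ultimately show ?thesis by (simp add: \<tau>_def transpose_def)
  qed
  \<comment> \<open>The cycle now starts with \<open>m j q * m q (\<sigma> j)\<close>. The second
    factor counts as an entry of row \<open>j\<close> once row \<open>q\<close> has been copied into
    row \<open>j\<close>, which is why the contracted term uses \<open>m(j := m q)\<close>.\<close>
  have cj: "cycle_prod m \<tau> j = m j q * cycle_prod (m(j := m q)) \<sigma> j"
  proof -
    have "map (\<lambda>q. m q (\<tau> q)) (tl (support \<sigma> j)) = map (\<lambda>qa. (m(j := m q)) qa (\<sigma> qa)) (tl (support \<sigma> j))"
      using tlx by (intro map_cong[OF refl]) blast
    then have "cycle_prod m \<tau> j = m j q * (m q (\<sigma> j) * prod_list (map (\<lambda>qa. (m(j := m q)) qa (\<sigma> qa)) (tl (support \<sigma> j))))"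
      unfolding cycle_prod_def sj by (simp only: list.map prod_list.Cons tj)
    also have "m q (\<sigma> j) * prod_list (map (\<lambda>qa. (m(j := m q)) qa (\<sigma> qa)) (tl (support \<sigma> j)))
      = cycle_prod (m(j := m q)) \<sigma> j"
      unfolding cycle_prod_def by (subst (2) sj0) (simp only: list.map prod_list.Cons fun_upd_same)
    finally show ?thesis .
  qed
  have fin: "finite ?S" using assms(1) by simp
  have prods: "prod_list (map (cycle_prod m \<tau>) (cycle_starts \<alpha> j \<tau>))
    = m j q * prod_list (map (cycle_prod (m(j := m q)) \<sigma>) (cycle_starts (\<alpha> - {q}) j \<sigma>))"
  proof -
    have "map (cycle_prod m \<tau>) (sorted_list_of_set ?S) = map (cycle_prod (m(j := m q)) \<sigma>) (sorted_list_of_set ?S)"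
      using co fin by (intro map_cong[OF refl]) (metis (no_types, lifting) set_sorted_list_of_set)
    then show ?thesis
      unfolding cs unfolding cycle_starts_def by (simp only: list.map prod_list.Cons cj mult.assoc)
  qed
  \<comment> \<open>Inserting \<open>q\<close> adds an element but no cycle, so the sign changes
    exactly once.\<close>
  have "length (cycle_starts (\<alpha> - {q}) j \<sigma>) \<le> card (\<alpha> - {q})"
    using assms by (intro length_cycle_starts_le) auto
  moreover have "card \<alpha> = Suc (card (\<alpha> - {q}))" using assms(1,3) by (metis card_Suc_Diff1)
  ultimately have sgn: "card \<alpha> - length (cycle_starts \<alpha> j \<tau>)
      = Suc (card (\<alpha> - {q}) - length (cycle_starts (\<alpha> - {q}) j \<sigma>))"
    unfolding cs by simp
  have comm: "(-1) ^ k * (x * y) = x * ((-1) ^ k * y)" for k and x y :: 'a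
    by (induct k) auto
  show ?thesis
    unfolding \<tau>_def[symmetric] rowdet_term_def prods sgn power_Suc
    by (simp add: comm)
qed

text \<open>The minimum of \<beta> is the start of its own cycle and the least of all starts, so the
  remaining list of starts is the one for row \<open>Min \<beta>\<close>. One more index and one
  more cycle leave the sign as it is.\<close>

lemma rowdet_term_fix:
  assumes "finite \<beta>" "j \<notin> \<beta>" "\<sigma> permutes \<beta>" "\<beta> \<noteq> {}"
  shows "rowdet_term (insert j \<beta>) j m \<sigma> = m j j * rowdet_term \<beta> (Min \<beta>) m \<sigma>"
proof -
  let ?k = "Min \<beta>"
  have k: "?k \<in> \<beta>" using assms by simp
  have perm: "permutation \<sigma>" using permutes_imp_permutation[OF _ assms(3)] assms(1) by simp
  have fj: "\<sigma> j = j" using assms(2,3) by (simp add: permutes_def)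
  let ?T = "{p \<in> \<beta>. p = Min (set (support \<sigma> p))}"
  have mk: "?k = Min (set (support \<sigma> ?k))"
  proof (rule sym, rule Min_eqI)
    show "finite (set (support \<sigma> ?k))" by simp
    show "?k \<in> set (support \<sigma> ?k)" by (rule start_in_support[OF perm])
    show "?k \<le> y" if "y \<in> set (support \<sigma> ?k)" for y
      using that support_subset[OF assms(3) k] assms(1) by (meson Min_le subsetD)
  qed
  then have kT: "?k \<in> ?T" using k by blast
  have "Min ?T = ?k"
    using kT assms(1) by (intro Min_eqI) auto
  then have sT: "sorted_list_of_set ?T = ?k # sorted_list_of_set (?T - {?k})"
    using sorted_list_of_set_nonempty[of ?T] kT assms(1) by auto
  have eq: "?T - {?k} = {p \<in> \<beta>. p \<notin> set (support \<sigma> ?k) \<and> p = Min (set (support \<sigma> p))}"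
  proof (rule equalityI; rule subsetI)
    fix p assume p: "p \<in> ?T - {?k}"
    have "p \<notin> set (support \<sigma> ?k)"
    proof
      assume "p \<in> set (support \<sigma> ?k)"
      then have "Min (set (support \<sigma> p)) = ?k" using support_same[OF perm] mk by metis
      then show False using p by simp
    qed
    then show "p \<in> {p \<in> \<beta>. p \<notin> set (support \<sigma> ?k) \<and> p = Min (set (support \<sigma> p))}" using p by blast
  next
    fix p assume "p \<in> {p \<in> \<beta>. p \<notin> set (support \<sigma> ?k) \<and> p = Min (set (support \<sigma> p))}"
    then show "p \<in> ?T - {?k}" using start_in_support[OF perm, of ?k] by blast
  qed
  have set1: "{p \<in> insert j \<beta>. p \<notin> set (support \<sigma> j) \<and> p = Min (set (support \<sigma> p))} = ?T"
    unfolding support_fixpoint[of \<sigma>, OF fj] using assms(2) by auto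
  have cs: "cycle_starts (insert j \<beta>) j \<sigma> = j # cycle_starts \<beta> ?k \<sigma>"
    unfolding cycle_starts_def set1 sT eq ..
  have cj: "cycle_prod m \<sigma> j = m j j"
    unfolding cycle_prod_def support_fixpoint[of \<sigma>, OF fj] by (simp add: fj)
  have comm: "(-1) ^ k * (x * y) = x * ((-1) ^ k * y)" for k and x y :: 'a
    by (induct k) auto
  show ?thesis
    unfolding rowdet_term_def cs using assms(1,2) by (simp add: cj comm)
qed

lemma sum_rowdet_term_fix:
  assumes "finite \<beta>" "j \<notin> \<beta>"
  shows "(\<Sum>\<sigma> | \<sigma> permutes \<beta>. rowdet_term (insert j \<beta>) j m \<sigma>) = m j j * restdet \<beta> m"
proof (cases "\<beta> = {}")
  case True
  have "cycle_starts {j} j id = [j]"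
    unfolding cycle_starts_def support_fixpoint[of id, OF id_apply] by simp
  moreover have "cycle_prod m id j = m j j"
    unfolding cycle_prod_def support_fixpoint[of id, OF id_apply] by simp
  ultimately show ?thesis using True by (simp add: restdet_def rowdet_term_def)
next
  case False
  then have "(\<Sum>\<sigma> | \<sigma> permutes \<beta>. rowdet_term (insert j \<beta>) j m \<sigma>)
    = (\<Sum>\<sigma> | \<sigma> permutes \<beta>. m j j * rowdet_term \<beta> (Min \<beta>) m \<sigma>)"
    using assms by (intro sum.cong) (auto simp: rowdet_term_fix)
  then show ?thesis using False by (simp add: restdet_def rowdet_def sum_distrib_left)
qed

text \<open>Permutations are grouped by the image \<open>q\<close> of \<open>j\<close>. For
  \<open>q = j\<close> the cycle of \<open>j\<close> is complete and splits off; otherwise composing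
  with \<open>transpose j q\<close> is a bijection onto the permutations that fix \<open>q\<close>.
  This takes the place of a Laplace expansion: row \<open>j\<close> is overwritten rather than
  deleted, and the first cycle is built up from the left.\<close>

theorem rowdet_rec:
  assumes "finite \<gamma>" "j \<notin> \<gamma>"
  shows "rowdet (insert j \<gamma>) j m = m j j * restdet \<gamma> m
    - (\<Sum>q\<in>\<gamma>. m j q * rowdet (insert j (\<gamma> - {q})) j (m(j := m q)))"
proof -
  let ?\<alpha> = "insert j \<gamma>"
  let ?f = "rowdet_term ?\<alpha> j m"
  have fin: "finite {\<sigma>. \<sigma> permutes ?\<alpha>}" using assms by (simp add: finite_permutations)
  have "rowdet ?\<alpha> j m = (\<Sum>q\<in>?\<alpha>. \<Sum>\<sigma> | \<sigma> \<in> {\<sigma>. \<sigma> permutes ?\<alpha>} \<and> \<sigma> j = q. ?f \<sigma>)"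
    unfolding rowdet_def using assms(1)
    by (intro sum.group[symmetric] fin) (auto dest: permutes_in_image[of _ _ j])
  also have "\<dots> = (\<Sum>\<sigma> | \<sigma> permutes ?\<alpha> \<and> \<sigma> j = j. ?f \<sigma>)
    + (\<Sum>q\<in>\<gamma>. \<Sum>\<sigma> | \<sigma> permutes ?\<alpha> \<and> \<sigma> j = q. ?f \<sigma>)"
    using assms by simp
  also have "{\<sigma>. \<sigma> permutes ?\<alpha> \<and> \<sigma> j = j} = {\<sigma>. \<sigma> permutes \<gamma>}"
    using assms(2) by (auto intro: permutes_superset permutes_subset simp: permutes_def)
  also have "(\<Sum>\<sigma> | \<sigma> permutes \<gamma>. ?f \<sigma>) = m j j * restdet \<gamma> m"
    by (rule sum_rowdet_term_fix[OF assms])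
  also have "(\<Sum>q\<in>\<gamma>. \<Sum>\<sigma> | \<sigma> permutes ?\<alpha> \<and> \<sigma> j = q. ?f \<sigma>)
    = (\<Sum>q\<in>\<gamma>. - (m j q * rowdet (insert j (\<gamma> - {q})) j (m(j := m q))))"
  proof (rule sum.cong[OF refl])
    fix q assume q: "q \<in> \<gamma>"
    then have jq: "j \<noteq> q" using assms(2) by auto
    have ins: "insert j (\<gamma> - {q}) = ?\<alpha> - {q}" using jq by auto
    have "(\<Sum>\<sigma> | \<sigma> permutes ?\<alpha> \<and> \<sigma> j = q. ?f \<sigma>)
      = (\<Sum>\<sigma> | \<sigma> permutes (?\<alpha> - {q}). ?f (\<sigma> \<circ> transpose j q))"
    proof (rule sum.reindex_bij_witness[where i = "\<lambda>\<sigma>. \<sigma> \<circ> transpose j q" and j = "\<lambda>\<sigma>. \<sigma> \<circ> transpose j q"])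
      fix \<sigma> assume "\<sigma> \<in> {\<sigma>. \<sigma> permutes ?\<alpha> \<and> \<sigma> j = q}"
      then have s: "\<sigma> permutes ?\<alpha>" "\<sigma> j = q" by auto
      show "\<sigma> \<circ> transpose j q \<circ> transpose j q = \<sigma>" by (simp add: comp_assoc)
      have "\<sigma> \<circ> transpose j q permutes ?\<alpha>"
        using q by (intro permutes_compose[OF permutes_swap_id s(1)]) auto
      then show "\<sigma> \<circ> transpose j q \<in> {\<sigma>. \<sigma> permutes (?\<alpha> - {q})}"
        using s(2) by (auto intro: permutes_superset)
      show "?f (\<sigma> \<circ> transpose j q \<circ> transpose j q) = ?f \<sigma>" by (simp add: comp_assoc)
    next
      fix \<sigma> assume "\<sigma> \<in> {\<sigma>. \<sigma> permutes (?\<alpha> - {q})}"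
      then have s: "\<sigma> permutes (?\<alpha> - {q})" by simp
      then have s': "\<sigma> permutes ?\<alpha>" by (rule permutes_subset) auto
      show "\<sigma> \<circ> transpose j q \<circ> transpose j q = \<sigma>" by (simp add: comp_assoc)
      have "\<sigma> \<circ> transpose j q permutes ?\<alpha>"
        using q by (intro permutes_compose[OF permutes_swap_id s']) auto
      moreover have "(\<sigma> \<circ> transpose j q) j = q" using s by (simp add: permutes_def)
      ultimately show "\<sigma> \<circ> transpose j q \<in> {\<sigma>. \<sigma> permutes ?\<alpha> \<and> \<sigma> j = q}" by simp
    qed
    also have "\<dots> = (\<Sum>\<sigma> | \<sigma> permutes (?\<alpha> - {q}). - (m j q * rowdet_term (?\<alpha> - {q}) j (m(j := m q)) \<sigma>))"
      using assms(1) q jq by (intro sum.cong[OF refl] rowdet_term_transpose) auto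
    also have "\<dots> = - (m j q * rowdet (insert j (\<gamma> - {q})) j (m(j := m q)))"
      unfolding ins rowdet_def by (simp add: sum_negf sum_distrib_left)
    finally show "(\<Sum>\<sigma> | \<sigma> permutes ?\<alpha> \<and> \<sigma> j = q. ?f \<sigma>) = - (m j q * rowdet (insert j (\<gamma> - {q})) j (m(j := m q)))" .
  qed
  finally show ?thesis by (simp add: sum_negf)
qed

subsection \<open>Sums over subsets\<close>

lemma Diff_right_commute: "A - B - C = A - C - (B :: 'a set)"
  by auto

lemma sum_Pow_insert:
  assumes "finite \<gamma>" "v \<notin> \<gamma>"
  shows "(\<Sum>\<delta>\<in>Pow (insert v \<gamma>). f \<delta>) = (\<Sum>\<delta>\<in>Pow \<gamma>. f \<delta>) + (\<Sum>\<delta>\<in>Pow \<gamma>. f (insert v \<delta>) :: 'a::comm_monoid_add)"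
proof -
  have "inj_on (insert v) (Pow \<gamma>)" using assms(2) by (auto simp: inj_on_def)
  then show ?thesis
    unfolding Pow_insert using assms
    by (subst sum.union_disjoint) (auto simp: sum.reindex)
qed

lemma sum_Pow_remove:
  fixes F :: "'b \<Rightarrow> 'b set \<Rightarrow> 'a::comm_monoid_add"
  assumes "finite \<gamma>"
  shows "(\<Sum>\<delta>\<in>Pow \<gamma>. \<Sum>q\<in>\<delta>. F q (\<delta> - {q})) = (\<Sum>q\<in>\<gamma>. \<Sum>\<delta>\<in>Pow (\<gamma> - {q}). F q \<delta>)"
proof -
  have fin: "finite \<delta>" if "\<delta> \<in> Pow \<gamma>" for \<delta> using that assms finite_subset by auto
  have "(\<Sum>\<delta>\<in>Pow \<gamma>. \<Sum>q\<in>\<delta>. F q (\<delta> - {q})) = (\<Sum>(\<delta>, q)\<in>Sigma (Pow \<gamma>) (\<lambda>\<delta>. \<delta>). F q (\<delta> - {q}))"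
    using assms fin by (intro sum.Sigma) auto
  also have "\<dots> = (\<Sum>(q, \<delta>)\<in>Sigma \<gamma> (\<lambda>q. Pow (\<gamma> - {q})). F q \<delta>)"
    by (rule sum.reindex_bij_witness[where i = "\<lambda>(q, \<delta>). (insert q \<delta>, q)" and j = "\<lambda>(\<delta>, q). (q, \<delta> - {q})"])
      (auto simp: insert_absorb)
  also have "\<dots> = (\<Sum>q\<in>\<gamma>. \<Sum>\<delta>\<in>Pow (\<gamma> - {q}). F q \<delta>)"
    using assms by (intro sum.Sigma[symmetric]) auto
  finally show ?thesis .
qed

text \<open>Both sides run over the ordered partitions of \<gamma> into three blocks, \<delta> being
  the union of the first two.\<close>

lemma sum_Pow_Pow:
  fixes g :: "'b set \<Rightarrow> 'b set \<Rightarrow> 'b set \<Rightarrow> 'a::comm_monoid_add"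
  assumes "finite \<gamma>"
  shows "(\<Sum>\<delta>\<in>Pow \<gamma>. \<Sum>\<epsilon>\<in>Pow \<delta>. g \<epsilon> (\<delta> - \<epsilon>) (\<gamma> - \<delta>))
    = (\<Sum>\<epsilon>\<in>Pow \<gamma>. \<Sum>\<eta>\<in>Pow (\<gamma> - \<epsilon>). g \<epsilon> \<eta> (\<gamma> - \<epsilon> - \<eta>))"
proof -
  have fin: "finite (Pow \<delta>)" if "\<delta> \<in> Pow \<gamma>" for \<delta> using that assms finite_subset by auto
  have "(\<Sum>\<delta>\<in>Pow \<gamma>. \<Sum>\<epsilon>\<in>Pow \<delta>. g \<epsilon> (\<delta> - \<epsilon>) (\<gamma> - \<delta>))
    = (\<Sum>(\<delta>, \<epsilon>)\<in>Sigma (Pow \<gamma>) Pow. g \<epsilon> (\<delta> - \<epsilon>) (\<gamma> - \<delta>))"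
    using assms fin by (intro sum.Sigma) auto
  also have "\<dots> = (\<Sum>(\<epsilon>, \<eta>)\<in>Sigma (Pow \<gamma>) (\<lambda>\<epsilon>. Pow (\<gamma> - \<epsilon>)). g \<epsilon> \<eta> (\<gamma> - \<epsilon> - \<eta>))"
    by (rule sum.reindex_bij_witness[where i = "\<lambda>(\<epsilon>, \<eta>). (\<epsilon> \<union> \<eta>, \<epsilon>)" and j = "\<lambda>(\<delta>, \<epsilon>). (\<epsilon>, \<delta> - \<epsilon>)"])
      (auto intro!: arg_cong[where f = "g _ _"])
  also have "\<dots> = (\<Sum>\<epsilon>\<in>Pow \<gamma>. \<Sum>\<eta>\<in>Pow (\<gamma> - \<epsilon>). g \<epsilon> \<eta> (\<gamma> - \<epsilon> - \<eta>))"
    using assms by (intro sum.Sigma[symmetric]) auto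
  finally show ?thesis .
qed

lemma sum_Pow_swap:
  fixes f :: "'b set \<Rightarrow> 'b set \<Rightarrow> 'a::comm_monoid_add"
  assumes "finite \<gamma>"
  shows "(\<Sum>\<delta>\<in>Pow \<gamma>. \<Sum>\<epsilon>\<in>Pow (\<gamma> - \<delta>). f \<delta> \<epsilon>) = (\<Sum>\<epsilon>\<in>Pow \<gamma>. \<Sum>\<delta>\<in>Pow (\<gamma> - \<epsilon>). f \<delta> \<epsilon>)"
proof -
  have "Pow (\<gamma> - \<delta>) = {\<epsilon> \<in> Pow \<gamma>. \<delta> \<inter> \<epsilon> = {}}" "Pow (\<gamma> - \<delta>) = {\<epsilon> \<in> Pow \<gamma>. \<epsilon> \<inter> \<delta> = {}}" for \<delta>
    by auto
  then show ?thesis using sum.swap_restrict[of "Pow \<gamma>" "Pow \<gamma>" f "\<lambda>\<delta> \<epsilon>. \<delta> \<inter> \<epsilon> = {}"] assms by simp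
qed

lemma sum_Pow_complement:
  assumes "finite \<gamma>"
  shows "(\<Sum>\<delta>\<in>Pow \<gamma>. f \<delta>) = (\<Sum>\<delta>\<in>Pow \<gamma>. f (\<gamma> - \<delta>))"
  by (rule sum.reindex_bij_witness[where i = "\<lambda>\<delta>. \<gamma> - \<delta>" and j = "\<lambda>\<delta>. \<gamma> - \<delta>"])
    (auto simp: double_diff)

subsection \<open>Sums over paths\<close>

text \<open>The signed sum, over all orderings \<open>q\<^sub>1, \<dots>, q\<^sub>k\<close> of the set \<open>\<delta>\<close>, of the products
  \<open>m a q\<^sub>1 * m q\<^sub>1 q\<^sub>2 * \<cdots> * m q\<^sub>k b\<close>; for \<open>a = b = j\<close> these are the cycles on \<open>insert j \<delta>\<close>.\<close>

function path_sum :: "(nat \<Rightarrow> nat \<Rightarrow> 'a::ring_1) \<Rightarrow> nat set \<Rightarrow> nat \<Rightarrow> nat \<Rightarrow> 'a" where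
  "path_sum m \<delta> a b = (if finite \<delta> \<and> \<delta> \<noteq> {}
     then - (\<Sum>q\<in>\<delta>. m a q * path_sum m (\<delta> - {q}) q b) else m a b)"
  by auto
termination
  by (relation "measure (\<lambda>(m, \<delta>, a, b). card \<delta>)") (auto simp: card_gt_0_iff)

declare path_sum.simps [simp del]

lemma path_sum_empty [simp]: "path_sum m {} a b = m a b"
  by (simp add: path_sum.simps)

lemma path_sum_left:
  "finite \<delta> \<Longrightarrow> \<delta> \<noteq> {} \<Longrightarrow> path_sum m \<delta> a b = - (\<Sum>q\<in>\<delta>. m a q * path_sum m (\<delta> - {q}) q b)"
  by (simp add: path_sum.simps[of m \<delta>])

text \<open>A path can be shortened at its last step as well as at its first. If \<delta> has at
  least two elements, removing both end steps in either order gives the same double sum.\<close>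

lemma path_sum_right:
  assumes "finite \<delta>" "\<delta> \<noteq> {}"
  shows "path_sum m \<delta> a b = - (\<Sum>q\<in>\<delta>. path_sum m (\<delta> - {q}) a q * m q b)"
  using assms
proof (induct "card \<delta>" arbitrary: \<delta> a rule: less_induct)
  case less
  show ?case
  proof (cases "card \<delta> = 1")
    case True
    then obtain q where "\<delta> = {q}" by (auto simp: card_1_singleton_iff)
    then show ?thesis by (simp add: path_sum_left)
  next
    case False
    have ne: "\<delta> - {q} \<noteq> {}" for q
    proof
      assume "\<delta> - {q} = {}"
      then have "\<delta> = {q}" using less.prems by auto
      then show False using False by simp
    qed
    have sw: "(\<Sum>q\<in>\<delta>. \<Sum>r\<in>\<delta> - {q}. f q r) = (\<Sum>r\<in>\<delta>. \<Sum>q\<in>\<delta> - {r}. f q r)" for f :: "nat \<Rightarrow> nat \<Rightarrow> 'a"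
    proof -
      have "\<delta> - {q} = {r \<in> \<delta>. q \<noteq> r}" "\<delta> - {q} = {r \<in> \<delta>. r \<noteq> q}" for q by auto
      then show ?thesis using sum.swap_restrict[of \<delta> \<delta> f "(\<noteq>)"] less.prems by simp
    qed
    have "path_sum m \<delta> a b = - (\<Sum>q\<in>\<delta>. m a q * path_sum m (\<delta> - {q}) q b)"
      using less.prems by (rule path_sum_left)
    also have "\<dots> = - (\<Sum>q\<in>\<delta>. m a q * - (\<Sum>r\<in>\<delta> - {q}. path_sum m (\<delta> - {q} - {r}) q r * m r b))"
      using less.prems ne by (intro arg_cong[where f = uminus] sum.cong refl arg_cong[where f = "(*) _"] less.hyps)
        (auto simp: card_gt_0_iff)
    also have "\<dots> = (\<Sum>q\<in>\<delta>. \<Sum>r\<in>\<delta> - {q}. m a q * path_sum m (\<delta> - {q} - {r}) q r * m r b)"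
      by (simp add: sum_negf sum_distrib_left mult.assoc)
    also have "\<dots> = (\<Sum>r\<in>\<delta>. \<Sum>q\<in>\<delta> - {r}. m a q * path_sum m (\<delta> - {q} - {r}) q r * m r b)"
      by (rule sw)
    also have "\<dots> = - (\<Sum>r\<in>\<delta>. path_sum m (\<delta> - {r}) a r * m r b)"
    proof -
      have "path_sum m (\<delta> - {r}) a r = - (\<Sum>q\<in>\<delta> - {r}. m a q * path_sum m (\<delta> - {q} - {r}) q r)" for r
        using less.prems(1) path_sum_left[OF _ ne, of r m a r] by (simp add: Diff_insert2[symmetric] insert_commute)
      then show ?thesis by (simp add: sum_negf sum_distrib_right)
    qed
    finally show ?thesis .
  qed
qed

text \<open>The weight \<open>K\<close> of the indices off the path is kept arbitrary: with
  \<open>restdet\<close> the identity becomes \<open>pathdet_rec\<close>, with a second path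
  starting at \<open>v\<close> it drives the induction for \<open>path_sum_split\<close>.\<close>

lemma path_sum_convolution_left:
  assumes "finite \<gamma>"
  shows "(\<Sum>\<delta>\<in>Pow \<gamma>. path_sum m \<delta> a b * K (\<gamma> - \<delta>))
    = m a b * K \<gamma> - (\<Sum>q\<in>\<gamma>. m a q * (\<Sum>\<delta>\<in>Pow (\<gamma> - {q}). path_sum m \<delta> q b * K (\<gamma> - {q} - \<delta>)))"
proof -
  have "(\<Sum>\<delta>\<in>Pow \<gamma>. path_sum m \<delta> a b * K (\<gamma> - \<delta>))
    = m a b * K \<gamma> + (\<Sum>\<delta>\<in>Pow \<gamma> - {{}}. path_sum m \<delta> a b * K (\<gamma> - \<delta>))"
    using assms by (subst sum.remove[of _ "{}"]) auto
  also have "(\<Sum>\<delta>\<in>Pow \<gamma> - {{}}. path_sum m \<delta> a b * K (\<gamma> - \<delta>))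
    = (\<Sum>\<delta>\<in>Pow \<gamma> - {{}}. - (\<Sum>q\<in>\<delta>. m a q * path_sum m (\<delta> - {q}) q b * K (\<gamma> - {q} - (\<delta> - {q}))))"
  proof (rule sum.cong[OF refl])
    fix \<delta> assume d: "\<delta> \<in> Pow \<gamma> - {{}}"
    then have "finite \<delta>" "\<delta> \<noteq> {}" using assms finite_subset by auto
    moreover have "\<gamma> - {q} - (\<delta> - {q}) = \<gamma> - \<delta>" if "q \<in> \<delta>" for q using that by auto
    ultimately show "path_sum m \<delta> a b * K (\<gamma> - \<delta>)
      = - (\<Sum>q\<in>\<delta>. m a q * path_sum m (\<delta> - {q}) q b * K (\<gamma> - {q} - (\<delta> - {q})))"
      by (simp add: path_sum_left[of \<delta>] sum_distrib_right)
  qed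
  also have "\<dots> = - (\<Sum>\<delta>\<in>Pow \<gamma>. \<Sum>q\<in>\<delta>. m a q * path_sum m (\<delta> - {q}) q b * K (\<gamma> - {q} - (\<delta> - {q})))"
    using assms unfolding sum_negf by (subst (2) sum.remove[of _ "{}"]) auto
  also have "\<dots> = - (\<Sum>q\<in>\<gamma>. \<Sum>\<delta>\<in>Pow (\<gamma> - {q}). m a q * path_sum m \<delta> q b * K (\<gamma> - {q} - \<delta>))"
    by (subst sum_Pow_remove[OF assms, of "\<lambda>q \<delta>. m a q * path_sum m \<delta> q b * K (\<gamma> - {q} - \<delta>)"]) (rule refl)
  finally show ?thesis by (simp add: sum_distrib_left mult.assoc)
qed

text \<open>Each path is cut at its visit to \<open>v\<close>. The sign of a path sum is given by
  the number of intermediate points, and \<open>v\<close> is an intermediate point of the whole path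
  but of neither piece; hence the minus.\<close>

lemma path_sum_split:
  assumes "finite \<delta>" "v \<notin> \<delta>"
  shows "path_sum m (insert v \<delta>) a b = - (\<Sum>\<epsilon>\<in>Pow \<delta>. path_sum m \<epsilon> a v * path_sum m (\<delta> - \<epsilon>) v b)"
  using assms
proof (induct "card \<delta>" arbitrary: \<delta> a rule: less_induct)
  case less
  have ins: "insert v \<delta> - {q} = insert v (\<delta> - {q})" if "q \<in> \<delta>" for q using that less.prems by auto
  have "path_sum m (insert v \<delta>) a b = - (m a v * path_sum m \<delta> v b
      + (\<Sum>q\<in>\<delta>. m a q * path_sum m (insert v \<delta> - {q}) q b))"
    using less.prems by (subst path_sum_left) auto
  also have "(\<Sum>q\<in>\<delta>. m a q * path_sum m (insert v \<delta> - {q}) q b)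
    = (\<Sum>q\<in>\<delta>. m a q * - (\<Sum>\<epsilon>\<in>Pow (\<delta> - {q}). path_sum m \<epsilon> q v * path_sum m (\<delta> - {q} - \<epsilon>) v b))"
  proof (intro sum.cong refl arg_cong[where f = "(*) _"])
    fix q assume q: "q \<in> \<delta>"
    have "card (\<delta> - {q}) < card \<delta>" using less.prems(1) q by (rule card_Diff1_less)
    from less.hyps[OF this, of q] less.prems q show "path_sum m (insert v \<delta> - {q}) q b
      = - (\<Sum>\<epsilon>\<in>Pow (\<delta> - {q}). path_sum m \<epsilon> q v * path_sum m (\<delta> - {q} - \<epsilon>) v b)"
      by (simp add: ins)
  qed
  finally show ?case
    using path_sum_convolution_left[OF less.prems(1), of m a v "\<lambda>\<epsilon>. path_sum m \<epsilon> v b"]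
    by (simp add: sum_negf)
qed

subsection \<open>Row determinants as sums over paths\<close>

text \<open>For \<open>a = b = j\<close> this is a row determinant along \<open>j\<close>, sorted by
  the cycle of \<open>j\<close>; for general \<open>a\<close> it is the one with row
  \<open>a\<close> copied into row \<open>j = b\<close>.\<close>

definition pathdet :: "(nat \<Rightarrow> nat \<Rightarrow> 'a::ring_1) \<Rightarrow> nat set \<Rightarrow> nat \<Rightarrow> nat \<Rightarrow> 'a" where
  "pathdet m \<gamma> a b = (\<Sum>\<delta>\<in>Pow \<gamma>. path_sum m \<delta> a b * restdet (\<gamma> - \<delta>) m)"

lemma pathdet_rec:
  assumes "finite \<gamma>"
  shows "pathdet m \<gamma> a b = m a b * restdet \<gamma> m - (\<Sum>q\<in>\<gamma>. m a q * pathdet m (\<gamma> - {q}) q b)"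
  unfolding pathdet_def by (rule path_sum_convolution_left[OF assms])

text \<open>After the first step to \<open>q\<close>, \<open>rowdet_rec\<close> leaves a row
  determinant whose row \<open>j\<close> is overwritten again, now by row \<open>q\<close>. The
  induction therefore has to range over all rows \<open>b\<close>.\<close>

theorem rowdet_replace_row:
  assumes "finite \<gamma>" "j \<notin> \<gamma>"
  shows "rowdet (insert j \<gamma>) j (m(j := b))
    = b j * restdet \<gamma> m - (\<Sum>q\<in>\<gamma>. b q * pathdet m (\<gamma> - {q}) q j)"
  using assms
proof (induct "card \<gamma>" arbitrary: \<gamma> b rule: less_induct)
  case less
  have 1: "restdet \<gamma> (m(j := b)) = restdet \<gamma> m"
    using less.prems by (intro restdet_cong) auto
  have 2: "rowdet (insert j (\<gamma> - {q})) j (m(j := m q)) = pathdet m (\<gamma> - {q}) q j" if "q \<in> \<gamma>" for q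
  proof -
    have "card (\<gamma> - {q}) < card \<gamma>" using less.prems(1) that by (rule card_Diff1_less)
    from less.hyps[OF this, of "m q"] less.prems show ?thesis
      by (subst pathdet_rec) auto
  qed
  have 3: "(m(j := b)) (j := (m(j := b)) q) = m(j := m q)" if "q \<in> \<gamma>" for q
    using that less.prems by auto
  have "(\<Sum>q\<in>\<gamma>. (m(j := b)) j q * rowdet (insert j (\<gamma> - {q})) j ((m(j := b)) (j := (m(j := b)) q)))
    = (\<Sum>q\<in>\<gamma>. b q * pathdet m (\<gamma> - {q}) q j)"
    by (rule sum.cong[OF refl]) (simp only: 2 3 fun_upd_same)
  then show ?case
    unfolding rowdet_rec[OF less.prems] 1 by (simp only: fun_upd_same)
qed

corollary rowdet_copy_row:
  assumes "finite \<gamma>" "j \<notin> \<gamma>"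
  shows "rowdet (insert j \<gamma>) j (m(j := m k)) = pathdet m \<gamma> k j"
  unfolding rowdet_replace_row[OF assms] pathdet_rec[OF assms(1)] ..

corollary rowdet_conv_pathdet:
  assumes "finite \<gamma>" "j \<notin> \<gamma>"
  shows "rowdet (insert j \<gamma>) j m = pathdet m \<gamma> j j"
  using rowdet_copy_row[OF assms, of m j] by simp

subsection \<open>Conjugation and real quaternions\<close>

lemmas quat_defs = quat_eq_iff zero_quat_def one_quat_def plus_quat_def uminus_quat_def
  minus_quat_def times_quat_def scaleR_quat_def qcnj_def

lemma quat_sel_simps [simp]:
  "qRe 0 = 0" "qRe 1 = 1" "qRe (x + y) = qRe x + qRe y" "qRe (x - y) = qRe x - qRe y"
  "qRe (- x) = - qRe x" "qRe (of_real r) = r"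
  by (simp_all add: quat_defs of_real_def)

lemma qcnj_simps [simp]:
  "qcnj 0 = 0" "qcnj 1 = 1" "qcnj (x + y) = qcnj x + qcnj y" "qcnj (x - y) = qcnj x - qcnj y"
  "qcnj (- x) = - qcnj x" "qcnj (x * y) = qcnj y * qcnj x" "qcnj (qcnj x) = x"
  "qcnj (of_real r) = of_real r"
  by (auto simp: quat_defs of_real_def algebra_simps)

lemma qcnj_sum [simp]: "qcnj (sum f A) = (\<Sum>x\<in>A. qcnj (f x))"
  by (induct A rule: infinite_finite_induct) auto

lemma qRe_sum [simp]: "qRe (sum f A) = (\<Sum>x\<in>A. qRe (f x))"
  by (induct A rule: infinite_finite_induct) auto

lemma qRe_mult_commute: "qRe (x * y) = qRe (y * x)"
  by (simp add: times_quat_def)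

lemma qRe_mult_qcnj: "qRe (x * qcnj x) = (qRe x)\<^sup>2 + (qIm1 x)\<^sup>2 + (qIm2 x)\<^sup>2 + (qIm3 x)\<^sup>2"
  by (simp add: quat_defs power2_eq_square)

lemma qRe_mult_qcnj_nonneg: "0 \<le> qRe (x * qcnj x)"
  by (simp add: qRe_mult_qcnj)

lemma qRe_mult_qcnj_eq_0: "qRe (x * qcnj x) = 0 \<Longrightarrow> x = 0"
  by (simp add: qRe_mult_qcnj quat_eq_iff zero_quat_def add_nonneg_eq_0_iff)

lemma quat_Reals_iff: "x \<in> \<real> \<longleftrightarrow> x = of_real (qRe x)"
  by (metis Reals_cases Reals_of_real quat_sel_simps(6))

lemma qcnj_eq_iff_Reals: "qcnj x = x \<longleftrightarrow> x \<in> \<real>"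
  unfolding quat_Reals_iff by (auto simp: quat_defs of_real_def)

lemma Reals_eq_iff_qRe: "x \<in> \<real> \<Longrightarrow> y \<in> \<real> \<Longrightarrow> qRe x = qRe y \<Longrightarrow> x = (y :: quat)"
  by (metis quat_Reals_iff)

lemma of_real_mult_commute: "of_real r * x = x * (of_real r :: 'a::real_algebra_1)"
  by (simp add: of_real_def)

lemma Reals_mult_commute: "x \<in> \<real> \<Longrightarrow> x * y = y * (x :: 'a::real_algebra_1)"
  by (auto elim!: Reals_cases simp: of_real_mult_commute)

subsection \<open>Row determinants of Hermitian matrices\<close>

locale hermitian_entries =
  fixes m :: "nat \<Rightarrow> nat \<Rightarrow> quat"
  assumes hermitian: "qcnj (m a b) = m b a"
begin

text \<open>Conjugation reverses the order of factors and transposes each entry, so it runs every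
  path backwards: a first step becomes a last step.\<close>

lemma qcnj_path_sum: "finite \<delta> \<Longrightarrow> qcnj (path_sum m \<delta> a b) = path_sum m \<delta> b a"
proof (induct "card \<delta>" arbitrary: \<delta> a rule: less_induct)
  case less
  show ?case
  proof (cases "\<delta> = {}")
    case False
    have "qcnj (path_sum m (\<delta> - {q}) q b) = path_sum m (\<delta> - {q}) b q" if "q \<in> \<delta>" for q
      using less.prems that by (intro less.hyps card_Diff1_less) auto
    then show ?thesis
      using less.prems False by (simp add: path_sum_left[of \<delta> m a] path_sum_right[of \<delta> m b] hermitian)
  qed (simp add: hermitian)
qed

lemma path_sum_Reals: "finite \<delta> \<Longrightarrow> path_sum m \<delta> a a \<in> \<real>"
  using qcnj_path_sum qcnj_eq_iff_Reals by blast

text \<open>Both sides sum over the cycles through \<open>j\<close> and \<open>k\<close>, started at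
  one or the other. Cutting such a cycle at both points leaves two arcs, whose product in either
  order has the same real part; since both sums are real, real parts suffice.\<close>

lemma path_sum_insert_swap:
  assumes "finite \<gamma>" "j \<notin> \<gamma>" "k \<notin> \<gamma>"
  shows "path_sum m (insert k \<gamma>) j j = path_sum m (insert j \<gamma>) k k"
proof (rule Reals_eq_iff_qRe)
  have "qRe (path_sum m (insert k \<gamma>) j j) = - (\<Sum>\<epsilon>\<in>Pow \<gamma>. qRe (path_sum m \<epsilon> j k * path_sum m (\<gamma> - \<epsilon>) k j))"
    unfolding path_sum_split[OF assms(1,3)] by simp
  also have "\<dots> = - (\<Sum>\<epsilon>\<in>Pow \<gamma>. qRe (path_sum m (\<gamma> - \<epsilon>) j k * path_sum m (\<gamma> - (\<gamma> - \<epsilon>)) k j))"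
    \<comment> \<open>Passing to complements exchanges the index sets of the two arcs.\<close>
    by (subst sum_Pow_complement[OF assms(1)]) (rule refl)
  also have "\<dots> = - (\<Sum>\<epsilon>\<in>Pow \<gamma>. qRe (path_sum m \<epsilon> k j * path_sum m (\<gamma> - \<epsilon>) j k))"
    by (intro arg_cong[where f = uminus] sum.cong refl, subst qRe_mult_commute) (auto simp: double_diff)
  also have "\<dots> = qRe (path_sum m (insert j \<gamma>) k k)"
    unfolding path_sum_split[OF assms(1,2)] by simp
  finally show "qRe (path_sum m (insert k \<gamma>) j j) = qRe (path_sum m (insert j \<gamma>) k k)" .
qed (use assms path_sum_Reals in auto)

text \<open>The cycle through \<open>k\<close> either avoids \<open>j\<close>, and then the cycles through \<open>j\<close> and \<open>k\<close> can be
  chosen in either order, or it is also the cycle through \<open>j\<close>.\<close>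

lemma pathdet_swap:
  assumes "finite \<gamma>" "j \<notin> \<gamma>" "k \<notin> \<gamma>"
    and expand: "\<And>\<delta> l. \<delta> \<subseteq> \<gamma> \<Longrightarrow> l \<in> {j, k} \<Longrightarrow> restdet (insert l \<delta>) m = pathdet m \<delta> l l"
  shows "pathdet m (insert k \<gamma>) j j = pathdet m (insert j \<gamma>) k k"
proof -
  \<comment> \<open>If \<open>l\<close> is off the cycle of \<open>i\<close>, the remaining
    determinant still contains \<open>l\<close> and is expanded along it by \<open>expand\<close>
    (first sum); otherwise \<open>l\<close> lies on that cycle (second sum).\<close>
  have expansion: "pathdet m (insert l \<gamma>) i i
      = (\<Sum>\<delta>\<in>Pow \<gamma>. \<Sum>\<epsilon>\<in>Pow (\<gamma> - \<delta>).
            path_sum m \<delta> i i * (path_sum m \<epsilon> l l * restdet (\<gamma> - \<delta> - \<epsilon>) m))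
        + (\<Sum>\<delta>\<in>Pow \<gamma>. path_sum m (insert l \<delta>) i i * restdet (\<gamma> - \<delta>) m)"
    if "l \<in> {j, k}" for i l
  proof -
    have l: "l \<notin> \<gamma>" using that assms by auto
    have "restdet (insert l \<gamma> - \<delta>) m = pathdet m (\<gamma> - \<delta>) l l" if d: "\<delta> \<in> Pow \<gamma>" for \<delta>
    proof -
      have "insert l \<gamma> - \<delta> = insert l (\<gamma> - \<delta>)" using d l by auto
      then show ?thesis using expand[of "\<gamma> - \<delta>" l] \<open>l \<in> {j, k}\<close> by simp
    qed
    then have "(\<Sum>\<delta>\<in>Pow \<gamma>. path_sum m \<delta> i i * restdet (insert l \<gamma> - \<delta>) m)
      = (\<Sum>\<delta>\<in>Pow \<gamma>. \<Sum>\<epsilon>\<in>Pow (\<gamma> - \<delta>).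
            path_sum m \<delta> i i * (path_sum m \<epsilon> l l * restdet (\<gamma> - \<delta> - \<epsilon>) m))"
      by (intro sum.cong refl) (simp add: pathdet_def sum_distrib_left)
    moreover have "insert l \<gamma> - insert l \<delta> = \<gamma> - \<delta>" for \<delta> using l by auto
    ultimately show ?thesis
      unfolding pathdet_def[of m "insert l \<gamma>"] sum_Pow_insert[OF assms(1) l] by simp
  qed
  have "path_sum m \<delta> j j * (path_sum m \<epsilon> k k * x) = path_sum m \<epsilon> k k * (path_sum m \<delta> j j * x)"
    if "\<delta> \<subseteq> \<gamma>" for \<delta> \<epsilon> x
    using Reals_mult_commute[OF path_sum_Reals, of \<delta> j] that assms(1)
    by (metis mult.assoc finite_subset)
  then have 1: "(\<Sum>\<delta>\<in>Pow \<gamma>. \<Sum>\<epsilon>\<in>Pow (\<gamma> - \<delta>).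
      path_sum m \<delta> j j * (path_sum m \<epsilon> k k * restdet (\<gamma> - \<delta> - \<epsilon>) m))
    = (\<Sum>\<epsilon>\<in>Pow \<gamma>. \<Sum>\<delta>\<in>Pow (\<gamma> - \<epsilon>).
      path_sum m \<epsilon> k k * (path_sum m \<delta> j j * restdet (\<gamma> - \<epsilon> - \<delta>) m))"
    by (subst sum_Pow_swap[OF assms(1)]) (auto intro!: sum.cong simp: Diff_right_commute)
  have 2: "path_sum m (insert k \<delta>) j j = path_sum m (insert j \<delta>) k k" if "\<delta> \<in> Pow \<gamma>" for \<delta>
    using that assms by (intro path_sum_insert_swap) (auto intro: finite_subset)
  show ?thesis
    using expansion[of k j] expansion[of j k] 1 2 by simp
qed

text \<open>By definition the determinant is expanded along its smallest index \<open>k\<close>, and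
  \<open>pathdet_swap\<close> trades \<open>k\<close> for \<open>j\<close>. The assumption
  \<open>expand\<close> made there is the induction hypothesis, because a set without
  \<open>k\<close> is smaller than \<gamma>.\<close>

lemma restdet_insert:
  assumes "finite \<gamma>" "j \<notin> \<gamma>"
  shows "restdet (insert j \<gamma>) m = pathdet m \<gamma> j j"
  using assms
proof (induct "card \<gamma>" arbitrary: \<gamma> j rule: less_induct)
  case less
  define k where "k = Min (insert j \<gamma>)"
  have k: "k \<in> insert j \<gamma>" using less.prems unfolding k_def by (metis Min_in finite_insert insert_not_empty)
  have "restdet (insert j \<gamma>) m = rowdet (insert k (insert j \<gamma> - {k})) k m"
    using k by (simp add: restdet_def k_def insert_absorb)
  also have "\<dots> = pathdet m (insert j \<gamma> - {k}) k k"
    using less.prems by (intro rowdet_conv_pathdet) auto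
  also have "\<dots> = pathdet m \<gamma> j j"
  proof (cases "k = j")
    case False
    let ?g = "\<gamma> - {k}"
    have g: "insert j \<gamma> - {k} = insert j ?g" "\<gamma> = insert k ?g" using False k by auto
    have "pathdet m (insert j ?g) k k = pathdet m (insert k ?g) j j"
    proof (rule pathdet_swap)
      fix \<delta> l assume d: "\<delta> \<subseteq> ?g" "l \<in> {k, j}"
      then have "finite \<delta>" using less.prems finite_subset by blast
      moreover have "card \<delta> < card \<gamma>"
        using d(1) k False less.prems(1) by (intro psubset_card_mono) auto
      ultimately show "restdet (insert l \<delta>) m = pathdet m \<delta> l l"
        using less.hyps d less.prems(2) by blast
    qed (use less.prems in auto)
    then show ?thesis using g by simp
  qed (use less.prems in simp)
  finally show ?case .
qed

corollary rowdet_eq_restdet: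
  assumes "finite \<alpha>" "j \<in> \<alpha>" shows "rowdet \<alpha> j m = restdet \<alpha> m"
  using rowdet_conv_pathdet[of "\<alpha> - {j}" j m] restdet_insert[of "\<alpha> - {j}" j] assms
  by (simp add: insert_absorb)

lemma restdet_Reals: "finite \<beta> \<Longrightarrow> restdet \<beta> m \<in> \<real>"
proof (induct "card \<beta>" arbitrary: \<beta> rule: less_induct)
  case less
  show ?case
  proof (cases "\<beta> = {}")
    case False
    then obtain j where j: "j \<in> \<beta>" by auto
    have "restdet \<beta> m = pathdet m (\<beta> - {j}) j j"
      using restdet_insert[of "\<beta> - {j}" j] less.prems j by (simp add: insert_absorb)
    also have "\<dots> \<in> \<real>"
      unfolding pathdet_def
    proof (intro sum_in_Reals Reals_mult)
      fix \<delta> assume d: "\<delta> \<in> Pow (\<beta> - {j})"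
      show "path_sum m \<delta> j j \<in> \<real>" using d less.prems by (intro path_sum_Reals) (auto intro: finite_subset)
      show "restdet (\<beta> - {j} - \<delta>) m \<in> \<real>"
        using less.prems j by (intro less.hyps psubset_card_mono) auto
    qed
    finally show ?thesis .
  qed (simp add: restdet_def)
qed

text \<open>A Hermitian matrix whose \<open>j\<close>th row is overwritten by its \<open>k\<close>th row has row determinant \<open>0\<close>:
  a path from \<open>k\<close> to \<open>j\<close> that returns to \<open>k\<close> starts with a cycle through \<open>k\<close>, whose separation from the
  path changes the sign.\<close>

lemma pathdet_insert_start:
  assumes "finite \<gamma>" "k \<notin> \<gamma>"
  shows "pathdet m (insert k \<gamma>) k j = 0"
proof -
  let ?f = "\<lambda>\<delta> \<epsilon> \<zeta>. path_sum m \<delta> k k * path_sum m \<epsilon> k j * restdet \<zeta> m"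
  have fin: "finite \<delta>" if "\<delta> \<subseteq> \<gamma>" for \<delta> using that assms finite_subset by blast
  have "pathdet m (insert k \<gamma>) k j
      = (\<Sum>\<delta>\<in>Pow \<gamma>. path_sum m \<delta> k j * restdet (insert k \<gamma> - \<delta>) m)
        + (\<Sum>\<delta>\<in>Pow \<gamma>. path_sum m (insert k \<delta>) k j * restdet (insert k \<gamma> - insert k \<delta>) m)"
    unfolding pathdet_def sum_Pow_insert[OF assms] ..
  \<comment> \<open>If the path does not return to \<open>k\<close>, the remaining determinant is
    expanded along \<open>k\<close>; the resulting cycle sum is real and can be moved in front of
    the path.\<close>
  also have "(\<Sum>\<delta>\<in>Pow \<gamma>. path_sum m \<delta> k j * restdet (insert k \<gamma> - \<delta>) m)
    = (\<Sum>\<delta>\<in>Pow \<gamma>. \<Sum>\<epsilon>\<in>Pow (\<gamma> - \<delta>). ?f \<epsilon> \<delta> (\<gamma> - \<delta> - \<epsilon>))"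
  proof (rule sum.cong[OF refl])
    fix \<delta> assume d: "\<delta> \<in> Pow \<gamma>"
    then have "insert k \<gamma> - \<delta> = insert k (\<gamma> - \<delta>)" using assms by auto
    then have "restdet (insert k \<gamma> - \<delta>) m = pathdet m (\<gamma> - \<delta>) k k"
      using restdet_insert[of "\<gamma> - \<delta>" k] assms by simp
    moreover have "path_sum m \<epsilon> k k * path_sum m \<delta> k j = path_sum m \<delta> k j * path_sum m \<epsilon> k k"
      if "\<epsilon> \<in> Pow (\<gamma> - \<delta>)" for \<epsilon>
      using that by (intro Reals_mult_commute path_sum_Reals fin) auto
    ultimately show "path_sum m \<delta> k j * restdet (insert k \<gamma> - \<delta>) m
      = (\<Sum>\<epsilon>\<in>Pow (\<gamma> - \<delta>). ?f \<epsilon> \<delta> (\<gamma> - \<delta> - \<epsilon>))"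
      by (simp add: pathdet_def sum_distrib_left mult.assoc)
  qed
  also have "\<dots> = (\<Sum>\<epsilon>\<in>Pow \<gamma>. \<Sum>\<delta>\<in>Pow (\<gamma> - \<epsilon>). ?f \<epsilon> \<delta> (\<gamma> - \<epsilon> - \<delta>))"
    by (subst sum_Pow_swap[OF assms(1)])
      (intro sum.cong refl arg_cong[where f = "?f _ _"], auto)
  \<comment> \<open>If the path returns to \<open>k\<close>, cutting it there yields the same cycle
    and path with the opposite sign.\<close>
  also have "(\<Sum>\<delta>\<in>Pow \<gamma>. path_sum m (insert k \<delta>) k j * restdet (insert k \<gamma> - insert k \<delta>) m)
    = (\<Sum>\<delta>\<in>Pow \<gamma>. - (\<Sum>\<epsilon>\<in>Pow \<delta>. ?f \<epsilon> (\<delta> - \<epsilon>) (\<gamma> - \<delta>)))"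
  proof (rule sum.cong[OF refl])
    fix \<delta> assume d: "\<delta> \<in> Pow \<gamma>"
    then have "finite \<delta>" "k \<notin> \<delta>" using fin assms by auto
    moreover have "insert k \<gamma> - insert k \<delta> = \<gamma> - \<delta>" using assms by auto
    ultimately show "path_sum m (insert k \<delta>) k j * restdet (insert k \<gamma> - insert k \<delta>) m
      = - (\<Sum>\<epsilon>\<in>Pow \<delta>. ?f \<epsilon> (\<delta> - \<epsilon>) (\<gamma> - \<delta>))"
      by (simp add: path_sum_split sum_distrib_right)
  qed
  also have "\<dots> = - (\<Sum>\<epsilon>\<in>Pow \<gamma>. \<Sum>\<delta>\<in>Pow (\<gamma> - \<epsilon>). ?f \<epsilon> \<delta> (\<gamma> - \<epsilon> - \<delta>))"
    using sum_Pow_Pow[OF assms(1), of ?f] by (simp add: sum_negf)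
  finally show ?thesis by simp
qed

end

subsection \<open>The generalized adjugate\<close>

lemma finite_index_sets [simp]: "finite (index_sets s n)"
  by (rule finite_subset[of _ "Pow {..<n}"]) (auto simp: index_sets_def)

lemma finite_index_sets_at [simp]: "finite (index_sets_at s n j)"
  by (simp add: index_sets_at_def)

lemma finite_in_index_sets: "\<alpha> \<in> index_sets s n \<Longrightarrow> finite \<alpha>"
  by (auto simp: index_sets_def intro: finite_subset)

lemma index_sets_empty: "index_sets s n = {}" if "n < s"
proof -
  have "card \<alpha> \<le> n" if "\<alpha> \<subseteq> {..<n}" for \<alpha>
    using card_mono[OF finite_lessThan that] by simp
  with that show ?thesis unfolding index_sets_def by (metis (mono_tags, lifting) Collect_empty_eq leD)
qed

lemma index_sets_0: "index_sets 0 n = {{}}"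
proof (rule equalityI; rule subsetI)
  fix \<alpha> assume a: "\<alpha> \<in> index_sets 0 n"
  then have "card \<alpha> = 0" by (simp add: index_sets_def)
  then show "\<alpha> \<in> {{}}" using card_0_eq[OF finite_in_index_sets[OF a]] by blast
next
  fix \<alpha> :: "nat set" assume "\<alpha> \<in> {{}}"
  then show "\<alpha> \<in> index_sets 0 n" by (simp add: index_sets_def)
qed

definition unit_row :: "nat \<Rightarrow> nat \<Rightarrow> 'a::zero_neq_one" where
  "unit_row q r = (if r = q then 1 else 0)"

context hermitian_entries
begin

definition minor_sum :: "nat \<Rightarrow> nat \<Rightarrow> real" where
  "minor_sum n s = (\<Sum>\<alpha>\<in>index_sets s n. qRe (restdet \<alpha> m))"

text \<open>The coefficients of the numerators of the determinantal representations, regarded as left linear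
  functions of the substituted row; for \<open>s = n\<close> this is the adjugate.\<close>

definition gen_adj :: "nat \<Rightarrow> nat \<Rightarrow> nat \<Rightarrow> nat \<Rightarrow> quat" where
  "gen_adj n s q j = (\<Sum>\<alpha>\<in>index_sets_at s n j. rowdet \<alpha> j (m(j := unit_row q)))"

lemma of_real_minor_sum: "of_real (minor_sum n s) = (\<Sum>\<alpha>\<in>index_sets s n. restdet \<alpha> m)"
  unfolding minor_sum_def of_real_sum
  by (intro sum.cong refl) (metis restdet_Reals finite_in_index_sets quat_Reals_iff)

lemma rowdet_unit_row:
  assumes "finite \<alpha>" "j \<in> \<alpha>"
  shows "rowdet \<alpha> j (m(j := unit_row q))
    = (if q = j then restdet (\<alpha> - {j}) m else if q \<in> \<alpha> then - pathdet m (\<alpha> - {j} - {q}) q j else 0)"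
proof -
  let ?\<gamma> = "\<alpha> - {j}"
  have "rowdet (insert j ?\<gamma>) j (m(j := unit_row q))
    = unit_row q j * restdet ?\<gamma> m - (\<Sum>r\<in>?\<gamma>. unit_row q r * pathdet m (?\<gamma> - {r}) r j)"
    using assms by (intro rowdet_replace_row) auto
  also have "(\<Sum>r\<in>?\<gamma>. unit_row q r * pathdet m (?\<gamma> - {r}) r j)
    = (\<Sum>r\<in>?\<gamma>. if r = q then pathdet m (?\<gamma> - {r}) r j else 0)"
    by (intro sum.cong) (auto simp: unit_row_def)
  finally have eq: "rowdet (insert j ?\<gamma>) j (m(j := unit_row q))
    = unit_row q j * restdet ?\<gamma> m - (\<Sum>r\<in>?\<gamma>. if r = q then pathdet m (?\<gamma> - {r}) r j else 0)" .
  have ins: "insert j ?\<gamma> = \<alpha>" using assms(2) by auto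
  show ?thesis
    unfolding eq[unfolded ins] using assms by (auto simp: unit_row_def)
qed

text \<open>Every term begins with its entry from row \<open>j\<close>, whence linearity for
  coefficients on the left. Unit rows with index outside \<alpha> contribute 0, so the sum may run
  over all columns.\<close>

lemma rowdet_linear:
  assumes "\<alpha> \<subseteq> {..<n}" "j \<in> \<alpha>"
  shows "rowdet \<alpha> j (m(j := b))
    = (\<Sum>q<n. b q * rowdet \<alpha> j (m(j := unit_row q)))"
proof -
  have fin: "finite \<alpha>" using assms(1) finite_subset by auto
  let ?\<gamma> = "\<alpha> - {j}"
  have "(\<Sum>q<n. b q * rowdet \<alpha> j (m(j := unit_row q)))
    = (\<Sum>q\<in>insert j ?\<gamma>. b q * rowdet \<alpha> j (m(j := unit_row q)))"
    using assms fin by (intro sum.mono_neutral_right) (auto simp: rowdet_unit_row)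
  also have "\<dots> = b j * restdet ?\<gamma> m - (\<Sum>q\<in>?\<gamma>. b q * pathdet m (?\<gamma> - {q}) q j)"
    using fin assms by (subst sum.insert) (auto simp: rowdet_unit_row sum_negf)
  also have "\<dots> = rowdet (insert j ?\<gamma>) j (m(j := b))"
    using fin by (intro rowdet_replace_row[symmetric]) auto
  finally show ?thesis using assms(2) by (simp add: insert_absorb)
qed

lemma sum_rowdet_linear:
  "(\<Sum>\<alpha>\<in>index_sets_at s n j. rowdet \<alpha> j (m(j := b))) = (\<Sum>q<n. b q * gen_adj n s q j)"
proof -
  have "(\<Sum>\<alpha>\<in>index_sets_at s n j. rowdet \<alpha> j (m(j := b)))
    = (\<Sum>\<alpha>\<in>index_sets_at s n j. \<Sum>q<n. b q * rowdet \<alpha> j (m(j := unit_row q)))"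
    by (intro sum.cong refl rowdet_linear) (auto simp: index_sets_at_def index_sets_def)
  then show ?thesis
    unfolding gen_adj_def sum_distrib_left by (subst sum.swap) simp
qed

lemma sum_mult_gen_adj:
  "(\<Sum>q<n. m k q * gen_adj n s q j) = (\<Sum>\<alpha>\<in>index_sets_at s n j. pathdet m (\<alpha> - {j}) k j)"
  unfolding sum_rowdet_linear[symmetric]
proof (rule sum.cong[OF refl])
  fix \<alpha> assume "\<alpha> \<in> index_sets_at s n j"
  then have "finite \<alpha>" "j \<in> \<alpha>" by (auto simp: index_sets_at_def finite_in_index_sets)
  then show "rowdet \<alpha> j (m(j := m k)) = pathdet m (\<alpha> - {j}) k j"
    using rowdet_copy_row[of "\<alpha> - {j}" j m k] by (simp add: insert_absorb)
qed

text \<open>On the diagonal, sets containing \<open>j\<close> contribute their minors to the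
  product, while the minors of sets avoiding \<open>j\<close> come from \<open>gen_adj\<close> at
  \<open>Suc s\<close> by deleting \<open>j\<close>. Off the diagonal, sets containing
  \<open>k\<close> drop out by \<open>pathdet_insert_start\<close>, and any other \<alpha> cancels
  against \<open>insert k \<alpha>\<close>.\<close>

theorem gen_adj_rec:
  assumes "k < n" "j < n"
  shows "(\<Sum>q<n. m k q * gen_adj n s q j) + gen_adj n (Suc s) k j
    = (if k = j then of_real (minor_sum n s) else 0)"
proof (cases "k = j")
  case True
  have "(\<Sum>\<alpha>\<in>index_sets_at s n j. pathdet m (\<alpha> - {j}) j j) = (\<Sum>\<alpha>\<in>index_sets_at s n j. restdet \<alpha> m)"
  proof (rule sum.cong[OF refl])
    fix \<alpha> assume "\<alpha> \<in> index_sets_at s n j"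
    then have "finite \<alpha>" "j \<in> \<alpha>" by (auto simp: index_sets_at_def finite_in_index_sets)
    then show "pathdet m (\<alpha> - {j}) j j = restdet \<alpha> m"
      using restdet_insert[of "\<alpha> - {j}" j] by (simp add: insert_absorb)
  qed
  moreover have "gen_adj n (Suc s) j j = (\<Sum>\<alpha>\<in>index_sets_at (Suc s) n j. restdet (\<alpha> - {j}) m)"
    unfolding gen_adj_def
    by (intro sum.cong refl) (auto simp: rowdet_unit_row index_sets_at_def finite_in_index_sets)
  moreover have "\<dots> = (\<Sum>\<alpha>\<in>index_sets s n - index_sets_at s n j. restdet \<alpha> m)"
  proof (rule sum.reindex_bij_witness[where i = "insert j" and j = "\<lambda>\<alpha>. \<alpha> - {j}"])
    fix \<alpha> assume "\<alpha> \<in> index_sets_at (Suc s) n j"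
    then have a: "\<alpha> \<subseteq> {..<n}" "card \<alpha> = Suc s" "j \<in> \<alpha>" "finite \<alpha>"
      by (auto simp: index_sets_at_def index_sets_def finite_subset)
    show "insert j (\<alpha> - {j}) = \<alpha>" using a(3) by auto
    show "\<alpha> - {j} \<in> index_sets s n - index_sets_at s n j"
      using a by (auto simp: index_sets_at_def index_sets_def)
  next
    fix \<alpha> assume "\<alpha> \<in> index_sets s n - index_sets_at s n j"
    then have a: "\<alpha> \<subseteq> {..<n}" "card \<alpha> = s" "j \<notin> \<alpha>" "finite \<alpha>"
      by (auto simp: index_sets_at_def index_sets_def finite_subset)
    show "insert j \<alpha> - {j} = \<alpha>" using a(3) by auto
    show "insert j \<alpha> \<in> index_sets_at (Suc s) n j"
      using a assms by (auto simp: index_sets_at_def index_sets_def)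
  qed simp
  moreover have "(\<Sum>\<alpha>\<in>index_sets s n. restdet \<alpha> m)
    = (\<Sum>\<alpha>\<in>index_sets s n - index_sets_at s n j. restdet \<alpha> m) + (\<Sum>\<alpha>\<in>index_sets_at s n j. restdet \<alpha> m)"
    by (rule sum.subset_diff) (auto simp: index_sets_at_def)
  ultimately show ?thesis
    using True by (simp add: sum_mult_gen_adj of_real_minor_sum)
next
  case False
  let ?J = "{\<alpha> \<in> index_sets_at s n j. k \<notin> \<alpha>}"
  have "(\<Sum>\<alpha>\<in>index_sets_at s n j. pathdet m (\<alpha> - {j}) k j) = (\<Sum>\<alpha>\<in>?J. pathdet m (\<alpha> - {j}) k j)"
  proof (intro sum.mono_neutral_right ballI)
    fix \<alpha> assume a: "\<alpha> \<in> index_sets_at s n j - ?J"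
    then have "finite \<alpha>" "\<alpha> - {j} = insert k (\<alpha> - {j} - {k})"
      using False by (auto simp: index_sets_at_def finite_in_index_sets)
    then show "pathdet m (\<alpha> - {j}) k j = 0"
      using pathdet_insert_start[of "\<alpha> - {j} - {k}" k j] by simp
  qed auto
  moreover have "gen_adj n (Suc s) k j
    = (\<Sum>\<alpha>\<in>{\<alpha> \<in> index_sets_at (Suc s) n j. k \<in> \<alpha>}. - pathdet m (\<alpha> - {j} - {k}) k j)"
    unfolding gen_adj_def using False
    by (intro sum.mono_neutral_cong_right)
      (auto simp: rowdet_unit_row index_sets_at_def finite_in_index_sets split: if_splits)
  moreover have "\<dots> = (\<Sum>\<alpha>\<in>?J. - pathdet m (\<alpha> - {j}) k j)"
  proof (rule sum.reindex_bij_witness[where i = "insert k" and j = "\<lambda>\<alpha>. \<alpha> - {k}"])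
    fix \<alpha> assume "\<alpha> \<in> {\<alpha> \<in> index_sets_at (Suc s) n j. k \<in> \<alpha>}"
    then have a: "\<alpha> \<subseteq> {..<n}" "card \<alpha> = Suc s" "j \<in> \<alpha>" "k \<in> \<alpha>" "finite \<alpha>"
      by (auto simp: index_sets_at_def index_sets_def finite_subset)
    show "insert k (\<alpha> - {k}) = \<alpha>" using a(4) by auto
    show "\<alpha> - {k} \<in> ?J" using a False by (auto simp: index_sets_at_def index_sets_def)
    show "- pathdet m (\<alpha> - {k} - {j}) k j = - pathdet m (\<alpha> - {j} - {k}) k j"
      by (simp only: Diff_right_commute)
  next
    fix \<alpha> assume "\<alpha> \<in> ?J"
    then have a: "\<alpha> \<subseteq> {..<n}" "card \<alpha> = s" "j \<in> \<alpha>" "k \<notin> \<alpha>" "finite \<alpha>"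
      by (auto simp: index_sets_at_def index_sets_def finite_subset)
    show "insert k \<alpha> - {k} = \<alpha>" using a(4) by auto
    show "insert k \<alpha> \<in> {\<alpha> \<in> index_sets_at (Suc s) n j. k \<in> \<alpha>}"
      using a assms by (auto simp: index_sets_at_def index_sets_def)
  qed
  ultimately show ?thesis
    using False by (simp add: sum_mult_gen_adj sum_negf)
qed

text \<open>The diagonal entry at \<open>j\<close> collects the minors of the sets that contain
  \<open>j\<close>, so each minor is counted once for each of its \<open>s\<close> elements.\<close>

lemma trace_gen_adj:
  "(\<Sum>j<n. qRe (\<Sum>q<n. m j q * gen_adj n s q j)) = real s * minor_sum n s"
proof -
  have "(\<Sum>j<n. qRe (\<Sum>q<n. m j q * gen_adj n s q j))
    = (\<Sum>j<n. \<Sum>\<alpha>\<in>{\<alpha> \<in> index_sets s n. j \<in> \<alpha>}. qRe (restdet \<alpha> m))"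
    unfolding sum_mult_gen_adj qRe_sum
  proof (intro sum.cong)
    fix j \<alpha> assume "\<alpha> \<in> {\<alpha> \<in> index_sets s n. j \<in> \<alpha>}"
    then have "finite \<alpha>" "j \<in> \<alpha>" by (auto simp: finite_in_index_sets)
    then show "qRe (pathdet m (\<alpha> - {j}) j j) = qRe (restdet \<alpha> m)"
      using restdet_insert[of "\<alpha> - {j}" j] by (simp add: insert_absorb)
  qed (auto simp: index_sets_at_def)
  also have "\<dots> = (\<Sum>\<alpha>\<in>index_sets s n. \<Sum>j\<in>{j \<in> {..<n}. j \<in> \<alpha>}. qRe (restdet \<alpha> m))"
    by (rule sum.swap_restrict) auto
  also have "\<dots> = (\<Sum>\<alpha>\<in>index_sets s n. real s * qRe (restdet \<alpha> m))"
  proof (rule sum.cong[OF refl])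
    fix \<alpha> assume "\<alpha> \<in> index_sets s n"
    then have "{j \<in> {..<n}. j \<in> \<alpha>} = \<alpha>" "card \<alpha> = s" by (auto simp: index_sets_def)
    then show "(\<Sum>j\<in>{j \<in> {..<n}. j \<in> \<alpha>}. qRe (restdet \<alpha> m)) = real s * qRe (restdet \<alpha> m)" by simp
  qed
  finally show ?thesis by (simp add: minor_sum_def sum_distrib_left)
qed

lemma minor_sum_0 [simp]: "minor_sum n 0 = 1"
  by (simp add: minor_sum_def index_sets_0 restdet_def)

lemma minor_sum_eq_0: "n < s \<Longrightarrow> minor_sum n s = 0"
  by (simp add: minor_sum_def index_sets_empty)

lemma gen_adj_eq_0: "n < s \<Longrightarrow> gen_adj n s q j = 0"
  by (simp add: gen_adj_def index_sets_empty index_sets_at_def)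

lemma gen_adj_0 [simp]: "gen_adj n 0 q j = 0"
  by (simp add: gen_adj_def index_sets_at_def index_sets_0 cong: conj_cong)

lemma herm_minor_eq:
  assumes "finite \<alpha>" "\<alpha> \<noteq> {}" "\<And>p q. p \<in> \<alpha> \<Longrightarrow> q \<in> \<alpha> \<Longrightarrow> M $$ (p, q) = m p q"
  shows "herm_minor M \<alpha> = qRe (restdet \<alpha> m)"
proof -
  have eq: "rdet \<alpha> i M = restdet \<alpha> m" if "i \<in> \<alpha>" for i
    using rowdet_cong[OF assms(1) that, of "\<lambda>p q. M $$ (p, q)" m] assms that
    by (simp add: rdet_conv_rowdet rowdet_eq_restdet)
  have re: "restdet \<alpha> m = of_real (qRe (restdet \<alpha> m))"
    using restdet_Reals[OF assms(1)] quat_Reals_iff by blast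
  obtain i where i: "i \<in> \<alpha>" using assms(2) by auto
  show ?thesis
    unfolding herm_minor_def
  proof (rule the_equality)
    show "\<forall>i\<in>\<alpha>. rdet \<alpha> i M = of_real (qRe (restdet \<alpha> m))" using eq re by metis
    fix d assume "\<forall>i\<in>\<alpha>. rdet \<alpha> i M = of_real d"
    then have "restdet \<alpha> m = of_real d" using eq i by metis
    then show "d = qRe (restdet \<alpha> m)" by simp
  qed
qed

end

subsection \<open>Quaternion matrices\<close>

lemma conj_transpose_carrier [simp]:
  "A \<in> carrier_mat nr nc \<Longrightarrow> conj_transpose A \<in> carrier_mat nc nr"
  by (simp add: conj_transpose_def)

lemma conj_transpose_dim [simp]:
  "dim_row (conj_transpose A) = dim_col A" "dim_col (conj_transpose A) = dim_row A"
  by (simp_all add: conj_transpose_def)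

lemma conj_transpose_index [simp]:
  "i < dim_col A \<Longrightarrow> j < dim_row A \<Longrightarrow> conj_transpose A $$ (i, j) = qcnj (A $$ (j, i))"
  by (simp add: conj_transpose_def)

lemma mult_mat_index_sum:
  "A \<in> carrier_mat nr k \<Longrightarrow> B \<in> carrier_mat k nc \<Longrightarrow> i < nr \<Longrightarrow> j < nc
    \<Longrightarrow> (A * B) $$ (i, j) = (\<Sum>l<k. A $$ (i, l) * B $$ (l, j))"
  by (simp add: scalar_prod_def atLeast0LessThan)

lemma conj_transpose_mult:
  assumes "A \<in> carrier_mat nr k" "B \<in> carrier_mat k nc"
  shows "conj_transpose (A * B) = conj_transpose B * conj_transpose A"
  using assms by (intro eq_matI) (auto simp: scalar_prod_def)

lemma conj_transpose_conj_transpose [simp]: "conj_transpose (conj_transpose A) = A"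
  by (intro eq_matI) auto

lemma conj_transpose_one [simp]: "conj_transpose (1\<^sub>m n) = 1\<^sub>m n"
  by (intro eq_matI) auto

lemma conj_transpose_minus:
  "A \<in> carrier_mat nr nc \<Longrightarrow> B \<in> carrier_mat nr nc
    \<Longrightarrow> conj_transpose (A - B) = conj_transpose A - conj_transpose B"
  by (intro eq_matI) auto

lemma conj_transpose_smult_of_real:
  "conj_transpose (of_real r \<cdot>\<^sub>m A) = of_real r \<cdot>\<^sub>m conj_transpose A"
  by (intro eq_matI) (auto simp: of_real_mult_commute)

lemma mult_smult_of_real:
  fixes A B :: "'a::real_algebra_1 mat"
  assumes "A \<in> carrier_mat nr k" "B \<in> carrier_mat k nc"
  shows "A * (of_real r \<cdot>\<^sub>m B) = of_real r \<cdot>\<^sub>m (A * B)"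
  using assms
  by (intro eq_matI) (auto simp: scalar_prod_def sum_distrib_left of_real_def)

lemma smult_of_real_mult:
  fixes A B :: "'a::real_algebra_1 mat"
  assumes "A \<in> carrier_mat nr k" "B \<in> carrier_mat k nc"
  shows "(of_real r \<cdot>\<^sub>m A) * B = of_real r \<cdot>\<^sub>m (A * B)"
  using assms by (intro eq_matI) (auto simp: scalar_prod_def sum_distrib_left mult.assoc)

section \<open>The real part of the trace, and cancellation in Gram matrices\<close>

definition re_trace :: "quat mat \<Rightarrow> real" where
  "re_trace A = (\<Sum>i<dim_row A. qRe (A $$ (i, i)))"

lemma re_trace_mult_commute:
  assumes "A \<in> carrier_mat n k" "B \<in> carrier_mat k n"
  shows "re_trace (A * B) = re_trace (B * A)"
proof -
  have "re_trace (A * B) = (\<Sum>i<n. \<Sum>l<k. qRe (A $$ (i, l) * B $$ (l, i)))"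
    using assms by (simp add: re_trace_def mult_mat_index_sum del: index_mult_mat(1))
  also have "\<dots> = (\<Sum>l<k. \<Sum>i<n. qRe (B $$ (l, i) * A $$ (i, l)))"
    by (subst sum.swap) (simp add: qRe_mult_commute)
  also have "\<dots> = re_trace (B * A)"
    using assms by (simp add: re_trace_def mult_mat_index_sum del: index_mult_mat(1))
  finally show ?thesis .
qed

lemma re_trace_one [simp]: "re_trace (1\<^sub>m n) = real n"
  by (simp add: re_trace_def)

lemma re_trace_smult_of_real:
  "A \<in> carrier_mat n n \<Longrightarrow> re_trace (of_real r \<cdot>\<^sub>m A) = r * re_trace A"
  by (simp add: re_trace_def sum_distrib_left times_quat_def of_real_def scaleR_quat_def one_quat_def)

lemma re_trace_minus:
  "A \<in> carrier_mat n n \<Longrightarrow> B \<in> carrier_mat n n \<Longrightarrow> re_trace (A - B) = re_trace A - re_trace B"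
  by (simp add: re_trace_def sum_subtractf)

text \<open>The trace is the sum of the squared norms of all entries. All later cancellations of a
  factor of a Gram matrix rest on this positivity.\<close>

lemma re_trace_mult_conj_transpose_eq_0:
  assumes A: "A \<in> carrier_mat nr nc" and tr: "re_trace (A * conj_transpose A) = 0"
  shows "A = 0\<^sub>m nr nc"
proof -
  have "re_trace (A * conj_transpose A) = (\<Sum>i<nr. \<Sum>l<nc. qRe (A $$ (i, l) * qcnj (A $$ (i, l))))"
    using A by (simp add: re_trace_def mult_mat_index_sum[of A nr nc _ nr] del: index_mult_mat(1))
  then have "\<forall>i<nr. \<forall>l<nc. qRe (A $$ (i, l) * qcnj (A $$ (i, l))) = 0"
    using tr by (simp add: sum_nonneg_eq_0_iff sum_nonneg qRe_mult_qcnj_nonneg del: qRe_sum)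
  then show ?thesis using A qRe_mult_qcnj_eq_0 by (intro eq_matI) auto
qed

lemma re_trace_zero [simp]: "re_trace (0\<^sub>m n n) = 0"
  by (simp add: re_trace_def)

lemma mult_conj_transpose_eq_0:
  assumes "A \<in> carrier_mat nr nc" "A * conj_transpose A = 0\<^sub>m nr nr"
  shows "A = 0\<^sub>m nr nc"
  using assms by (intro re_trace_mult_conj_transpose_eq_0) auto

text \<open>Multiplying the hypothesis by the conjugate transpose of \<open>M\<close> turns it into
  the vanishing of the Gram matrix of \<open>M * A\<close>.\<close>

lemma mult_gram_eq_0:
  assumes M: "M \<in> carrier_mat k nr" and A: "A \<in> carrier_mat nr nc"
    and 0: "M * (A * conj_transpose A) = 0\<^sub>m k nr"
  shows "M * A = 0\<^sub>m k nc"
proof (rule mult_conj_transpose_eq_0)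
  have "M * A * conj_transpose (M * A) = M * (A * conj_transpose A) * conj_transpose M"
  proof -
    have c: "conj_transpose A \<in> carrier_mat nc nr" "conj_transpose M \<in> carrier_mat nr k"
      "A * conj_transpose A \<in> carrier_mat nr nr" "conj_transpose A * conj_transpose M \<in> carrier_mat nc k"
      using M A by auto
    show ?thesis
      unfolding conj_transpose_mult[OF M A] assoc_mult_mat[OF M A c(4)] assoc_mult_mat[OF A c(1,2)]
        assoc_mult_mat[OF M c(3,2)] ..
  qed
  then show "M * A * conj_transpose (M * A) = 0\<^sub>m k k" using M by (simp add: 0)
qed (use M A in simp)

lemma minus_mat_eq_0:
  fixes A B :: "'a::group_add mat"
  assumes "A \<in> carrier_mat nr nc" "B \<in> carrier_mat nr nc" "A - B = 0\<^sub>m nr nc"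
  shows "A = B"
proof (rule eq_matI)
  fix i j assume "i < dim_row B" "j < dim_col B"
  then have ij: "i < nr" "j < nc" using assms(2) by auto
  have "(A - B) $$ (i, j) = 0" unfolding assms(3) using ij by simp
  moreover have "(A - B) $$ (i, j) = A $$ (i, j) - B $$ (i, j)"
    using ij assms(2) by (intro index_minus_mat) auto
  ultimately show "A $$ (i, j) = B $$ (i, j)" by simp
qed (use assms(1,2) in auto)

lemma right_cancel_gram:
  assumes M: "M \<in> carrier_mat k nr" "M' \<in> carrier_mat k nr" and A: "A \<in> carrier_mat nr nc"
    and eq: "M * (A * conj_transpose A) = M' * (A * conj_transpose A)"
  shows "M * A = M' * A"
proof -
  define K where "K = A * conj_transpose A"
  have K: "K \<in> carrier_mat nr nr" using A by (simp add: K_def)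
  have "(M - M') * K = M' * K - M' * K"
    unfolding minus_mult_distrib_mat[OF M K] using eq by (simp only: K_def)
  also have "\<dots> = 0\<^sub>m k nr" by (rule minus_r_inv_mat) (use M K in simp)
  finally have "(M - M') * A = 0\<^sub>m k nc"
    unfolding K_def by (rule mult_gram_eq_0[OF minus_carrier_mat[OF M(2)] A])
  then have "M * A - M' * A = 0\<^sub>m k nc" by (simp only: minus_mult_distrib_mat[OF M A])
  then show ?thesis
    by (rule minus_mat_eq_0[OF mult_carrier_mat[OF M(1) A] mult_carrier_mat[OF M(2) A]])
qed

subsection \<open>The Moore-Penrose inverse\<close>

lemma moore_penrose_unique:
  assumes A: "A \<in> carrier_mat n n" and X: "is_moore_penrose A X" and Y: "is_moore_penrose A Y"
  shows "X = Y"
proof -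
  have c: "X \<in> carrier_mat n n" "Y \<in> carrier_mat n n"
    using A X Y by (auto simp: is_moore_penrose_def)
  have x: "A * X * A = A" "X * A * X = X" "conj_transpose (A * X) = A * X" "conj_transpose (X * A) = X * A"
    using X by (auto simp: is_moore_penrose_def)
  have y: "A * Y * A = A" "Y * A * Y = Y" "conj_transpose (A * Y) = A * Y" "conj_transpose (Y * A) = Y * A"
    using Y by (auto simp: is_moore_penrose_def)
  have "A * X = A * Y * A * X" using y(1) by simp
  also have "\<dots> = (A * Y) * (A * X)" using A c by (simp add: assoc_mult_mat[of _ n n _ n _ n])
  also have "\<dots> = conj_transpose (A * X * (A * Y))"
    using A c x y by (simp add: conj_transpose_mult[of "A * X" n n "A * Y" n])
  also have "A * X * (A * Y) = A * X * A * Y" using A c by (simp add: assoc_mult_mat[of _ n n _ n _ n])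
  finally have 1: "A * X = A * Y" using x y by simp
  have "X * A = X * (A * Y * A)" using y(1) by simp
  also have "\<dots> = (X * A) * (Y * A)" using A c by (simp add: assoc_mult_mat[of _ n n _ n _ n])
  also have "\<dots> = conj_transpose (Y * A * (X * A))"
    using A c x y by (simp add: conj_transpose_mult[of "Y * A" n n "X * A" n])
  also have "Y * A * (X * A) = Y * (A * X * A)" using A c by (simp add: assoc_mult_mat[of _ n n _ n _ n])
  finally have 2: "X * A = Y * A" using x y by simp
  have "X = X * A * X" using x by simp
  also have "\<dots> = Y * A * X" using 2 by simp
  also have "\<dots> = Y * (A * X)" using A c by simp
  also have "\<dots> = Y * (A * Y)" using 1 by simp
  also have "\<dots> = Y" using A c y by simp
  finally show ?thesis .
qed

lemma moore_penrose_eqI: "A \<in> carrier_mat n n \<Longrightarrow> is_moore_penrose A X \<Longrightarrow> moore_penrose A = X"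
  unfolding moore_penrose_def by (rule the_equality) (auto intro: moore_penrose_unique)

text \<open>Cancelling the right factor \<open>conj_transpose A\<close> in
  \<open>H * N * H = H\<close> gives \<open>H * N * A = A\<close>, and its conjugate gives the
  second Penrose equation. Both symmetry conditions come from \<open>N\<close> being Hermitian, the
  first also from its commuting with \<open>H\<close>.\<close>

lemma is_moore_penrose_gram:
  assumes A: "A \<in> carrier_mat n n" and N: "N \<in> carrier_mat n n" "conj_transpose N = N"
    and H: "H = A * conj_transpose A" and comm: "N * H = H * N" and HNH: "H * N * H = H"
  shows "is_moore_penrose A (conj_transpose A * N)"
proof -
  let ?B = "conj_transpose A"
  have B: "?B \<in> carrier_mat n n" using A by simp
  have Hc: "H \<in> carrier_mat n n" "conj_transpose H = H"
    using A H by (auto simp: conj_transpose_mult[OF A B])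
  have HN: "H * N \<in> carrier_mat n n" by (rule mult_carrier_mat[OF Hc(1) N(1)])
  have "H * N * A = 1\<^sub>m n * A"
    by (rule right_cancel_gram[OF HN one_carrier_mat A]) (use HNH Hc in \<open>simp flip: H\<close>)
  then have HNA: "H * N * A = A" using A by simp
  have AY: "A * (?B * N) = H * N" using A B N H by (simp add: assoc_mult_mat[of _ n n _ n _ n])
  have "conj_transpose (H * N * A) = ?B * (N * H)"
    using Hc N A by (simp add: conj_transpose_mult[of _ n n _ n] assoc_mult_mat[of _ n n _ n _ n])
  then have BNH: "?B * (N * H) = ?B" using HNA by simp
  show ?thesis
    unfolding is_moore_penrose_def
  proof (intro conjI)
    show "?B * N \<in> carrier_mat (dim_col A) (dim_row A)"
      using A mult_carrier_mat[OF B N(1)] by simp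
    show "A * (?B * N) * A = A" using AY HNA by simp
    have "?B * N * A * (?B * N) = ?B * (N * H) * N"
      using A B N H by (simp add: assoc_mult_mat[of _ n n _ n _ n] mult_carrier_mat[of _ n n _ n])
    then show "?B * N * A * (?B * N) = ?B * N" using BNH by simp
    show "conj_transpose (A * (?B * N)) = A * (?B * N)"
      unfolding AY using Hc N comm by (simp add: conj_transpose_mult[of _ n n _ n])
    show "conj_transpose (?B * N * A) = ?B * N * A"
      using A B N by (simp add: conj_transpose_mult[of _ n n _ n] assoc_mult_mat[of _ n n _ n _ n])
  qed
qed

subsection \<open>Rank\<close>

text \<open>Coefficients are a function on all indices whose values past the list are ignored, so
  the same \<open>c\<close> serves \<open>bs\<close> and \<open>bs @ [v]\<close>.\<close>

definition right_lincomb :: "nat \<Rightarrow> quat vec list \<Rightarrow> (nat \<Rightarrow> quat) \<Rightarrow> quat vec" where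
  "right_lincomb n bs c = vec n (\<lambda>i. \<Sum>j<length bs. bs ! j $ i * c j)"

lemma mat_of_cols_mult_vec:
  "c \<in> carrier_vec (length bs) \<Longrightarrow> mat_of_cols n bs *\<^sub>v c = right_lincomb n bs (\<lambda>j. c $ j)"
  by (intro eq_vecI) (auto simp: right_lincomb_def scalar_prod_def mat_of_cols_def atLeast0LessThan)

lemma right_lincomb_cong: "(\<And>j. j < length bs \<Longrightarrow> c j = d j) \<Longrightarrow> right_lincomb n bs c = right_lincomb n bs d"
  by (simp add: right_lincomb_def)

lemma range_right_lincomb:
  "{mat_of_cols n bs *\<^sub>v c | c. c \<in> carrier_vec (length bs)} = range (right_lincomb n bs)"
proof (intro equalityI subsetI)
  fix y assume "y \<in> range (right_lincomb n bs)"
  then obtain c where "y = right_lincomb n bs c" by auto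
  then have "y = mat_of_cols n bs *\<^sub>v vec (length bs) c"
    by (simp add: mat_of_cols_mult_vec cong: right_lincomb_cong)
  then show "y \<in> {mat_of_cols n bs *\<^sub>v c | c. c \<in> carrier_vec (length bs)}" using vec_carrier by blast
qed (auto simp: mat_of_cols_mult_vec)

lemma right_lincomb_snoc:
  "right_lincomb n (bs @ [v]) c = vec n (\<lambda>i. right_lincomb n bs c $ i + v $ i * c (length bs))"
  by (intro eq_vecI) (auto simp: right_lincomb_def nth_append)

lemma right_lincomb_add_mult:
  "right_lincomb n bs (\<lambda>j. c j + d j * t) = vec n (\<lambda>i. right_lincomb n bs c $ i + right_lincomb n bs d $ i * t)"
  by (intro eq_vecI) (auto simp: right_lincomb_def sum.distrib sum_distrib_right algebra_simps)

lemma right_lincomb_0 [simp]: "right_lincomb n bs (\<lambda>_. 0) = 0\<^sub>v n"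
  by (intro eq_vecI) (auto simp: right_lincomb_def)

lemma independent_generators_exist:
  assumes "set vs \<subseteq> carrier_vec n"
  shows "\<exists>bs. set bs \<subseteq> carrier_vec n
    \<and> (\<forall>c. right_lincomb n bs c = 0\<^sub>v n \<longrightarrow> (\<forall>j<length bs. c j = 0))
    \<and> range (right_lincomb n bs) = range (right_lincomb n vs)"
  using assms
proof (induct vs rule: rev_induct)
  case Nil
  show ?case by (rule exI[of _ "[]"]) simp
next
  case (snoc v vs)
  then obtain bs where bs: "set bs \<subseteq> carrier_vec n"
      "\<And>c. right_lincomb n bs c = 0\<^sub>v n \<Longrightarrow> \<forall>j<length bs. c j = 0"
      "range (right_lincomb n bs) = range (right_lincomb n vs)"
    by auto
  have v: "v \<in> carrier_vec n" using snoc.prems by simp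
  have range_snoc: "range (right_lincomb n (us @ [v]))
    = {vec n (\<lambda>i. x $ i + v $ i * t) | x t. x \<in> range (right_lincomb n us)}" for us
  proof (intro equalityI subsetI)
    fix y assume "y \<in> {vec n (\<lambda>i. x $ i + v $ i * t) | x t. x \<in> range (right_lincomb n us)}"
    then obtain c t where "y = vec n (\<lambda>i. right_lincomb n us c $ i + v $ i * t)" by blast
    then have "y = right_lincomb n (us @ [v]) (c(length us := t))"
      by (simp add: right_lincomb_snoc cong: right_lincomb_cong)
    then show "y \<in> range (right_lincomb n (us @ [v]))" by blast
  qed (auto simp: right_lincomb_snoc)
  show ?case
  proof (cases "v \<in> range (right_lincomb n bs)")
    case True
    then obtain d where d: "v = right_lincomb n bs d" by auto
    have "range (right_lincomb n bs) = range (right_lincomb n (vs @ [v]))"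
      unfolding range_snoc bs(3)[symmetric]
    proof (intro equalityI subsetI)
      fix y assume "y \<in> range (right_lincomb n bs)"
      moreover from this have "y = vec n (\<lambda>i. y $ i + v $ i * 0)" by (auto simp: right_lincomb_def)
      ultimately show "y \<in> {vec n (\<lambda>i. x $ i + v $ i * t) |x t. x \<in> range (right_lincomb n bs)}" by blast
    next
      fix y assume "y \<in> {vec n (\<lambda>i. x $ i + v $ i * t) |x t. x \<in> range (right_lincomb n bs)}"
      then obtain c t where "y = vec n (\<lambda>i. right_lincomb n bs c $ i + v $ i * t)" by blast
      then have "y = right_lincomb n bs (\<lambda>j. c j + d j * t)" unfolding d right_lincomb_add_mult .
      then show "y \<in> range (right_lincomb n bs)" by blast
    qed
    then show ?thesis using bs by blast
  next
    case False
    have "\<forall>j<length (bs @ [v]). c j = 0" if c: "right_lincomb n (bs @ [v]) c = 0\<^sub>v n" for c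
    proof -
      let ?t = "c (length bs)"
      have eq: "right_lincomb n bs c $ i + v $ i * ?t = 0" if "i < n" for i
        using arg_cong[OF c, of "\<lambda>x. x $ i"] that unfolding right_lincomb_snoc by simp
      have t: "?t = 0"
      proof (rule ccontr)
        assume t: "?t \<noteq> 0"
        have "v $ i = right_lincomb n bs c $ i * - inverse ?t" if "i < n" for i
        proof -
          have "v $ i * ?t = - right_lincomb n bs c $ i" using eq[OF that] by (simp add: add_eq_0_iff)
          then have "v $ i * ?t * inverse ?t = - right_lincomb n bs c $ i * inverse ?t" by simp
          then show ?thesis using t by (simp add: mult.assoc)
        qed
        \<comment> \<open>The summand 0 brings the coefficients into the shape of
          \<open>right_lincomb_add_mult\<close>; the inverse stands on the right because scalars act
          from the right.\<close>
        then have "v = right_lincomb n bs (\<lambda>j. 0 + c j * - inverse ?t)"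
          unfolding right_lincomb_add_mult using v by (intro eq_vecI) auto
        then show False using False by blast
      qed
      then have "right_lincomb n bs c = 0\<^sub>v n"
        using eq by (intro eq_vecI) (auto simp: right_lincomb_def)
      then show ?thesis using bs(2) t by (simp add: less_Suc_eq)
    qed
    moreover have "range (right_lincomb n (bs @ [v])) = range (right_lincomb n (vs @ [v]))"
      unfolding range_snoc bs(3) ..
    ultimately show ?thesis using bs(1) v by (intro exI[of _ "bs @ [v]"]) auto
  qed
qed

lemma right_basis_exists:
  assumes "A \<in> carrier_mat n m"
  shows "\<exists>bs. right_basis n (right_col_space A) bs"
proof -
  have "set (cols A) \<subseteq> carrier_vec n" using assms by (auto simp: cols_def)
  then obtain bs where bs: "set bs \<subseteq> carrier_vec n"
      "\<And>c. right_lincomb n bs c = 0\<^sub>v n \<Longrightarrow> \<forall>j<length bs. c j = 0"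
      "range (right_lincomb n bs) = range (right_lincomb n (cols A))"
    using independent_generators_exist by blast
  have "mat_of_cols n (cols A) = A" using mat_of_cols_cols[of A] assms by simp
  then have "right_col_space A = range (right_lincomb n (cols A))"
    unfolding right_col_space_def range_right_lincomb[symmetric] by simp
  then have "right_basis n (right_col_space A) bs"
    unfolding right_basis_def range_right_lincomb using bs
    by (auto simp: mat_of_cols_mult_vec intro!: eq_vecI)
  then show ?thesis ..
qed

lemma right_col_space_subset_iff:
  assumes X: "X \<in> carrier_mat n m" and A: "A \<in> carrier_mat n k"
  shows "right_col_space X \<subseteq> right_col_space A \<longleftrightarrow> (\<exists>Z \<in> carrier_mat k m. X = A * Z)"
proof
  assume sub: "right_col_space X \<subseteq> right_col_space A"
  have "\<exists>z. z \<in> carrier_vec k \<and> col X j = A *\<^sub>v z" if j: "j < m" for j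
  proof -
    have "col X j = X *\<^sub>v unit_vec m j" using X j by (intro eq_vecI) auto
    moreover have "unit_vec m j \<in> carrier_vec (dim_col X)" using X by simp
    ultimately have "col X j \<in> right_col_space X"
      unfolding right_col_space_def by (intro CollectI exI conjI)
    then show ?thesis using sub A unfolding right_col_space_def by blast
  qed
  then obtain z where z: "\<And>j. j < m \<Longrightarrow> z j \<in> carrier_vec k \<and> col X j = A *\<^sub>v z j" by metis
  let ?Z = "mat k m (\<lambda>(i, j). z j $ i)"
  have "X = A * ?Z"
  proof (rule eq_matI)
    fix i j assume ij: "i < dim_row (A * ?Z)" "j < dim_col (A * ?Z)"
    then have j: "j < m" "i < n" using A by auto
    have "col ?Z j = z j" using z[OF j(1)] j by (intro eq_vecI) auto
    then have "(A * ?Z) $$ (i, j) = (A *\<^sub>v z j) $ i" using A j by simp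
    also have "\<dots> = col X j $ i" using z[OF j(1)] by simp
    finally show "X $$ (i, j) = (A * ?Z) $$ (i, j)" using X j by simp
  qed (use X A in auto)
  then show "\<exists>Z \<in> carrier_mat k m. X = A * Z" by (intro bexI[of _ ?Z]) auto
next
  assume "\<exists>Z \<in> carrier_mat k m. X = A * Z"
  then obtain Z where Z: "Z \<in> carrier_mat k m" "X = A * Z" by blast
  show "right_col_space X \<subseteq> right_col_space A"
  proof
    fix y assume "y \<in> right_col_space X"
    then obtain x where "x \<in> carrier_vec m" "y = X *\<^sub>v x" using X by (auto simp: right_col_space_def)
    then have "y = A *\<^sub>v (Z *\<^sub>v x)" "Z *\<^sub>v x \<in> carrier_vec k" using A Z by auto
    then show "y \<in> right_col_space A" using A unfolding right_col_space_def by auto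
  qed
qed

text \<open>An idempotent \<open>B * E\<close> with injective \<open>B\<close> satisfies \<open>E * B = 1\<close>, and the real part of the
  trace does not change when \<open>B\<close> and \<open>E\<close> are exchanged.\<close>

lemma length_right_basis:
  assumes A: "A \<in> carrier_mat n m" and Y: "Y \<in> carrier_mat m n" and AYA: "A * Y * A = A"
    and basis: "right_basis n (right_col_space A) bs"
  shows "real (length bs) = re_trace (A * Y)"
proof -
  let ?k = "length bs" let ?B = "mat_of_cols n bs"
  have B: "?B \<in> carrier_mat n ?k" by simp
  have "right_col_space ?B = right_col_space A"
    using basis unfolding right_basis_def right_col_space_def by simp
  then obtain C D where C: "C \<in> carrier_mat ?k m" "A = ?B * C" and D: "D \<in> carrier_mat m ?k" "?B = A * D"
    using right_col_space_subset_iff[OF A B] right_col_space_subset_iff[OF B A] by auto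
  define E where "E = C * Y"
  have E: "E \<in> carrier_mat ?k n" using C Y by (simp add: E_def)
  have AY: "A * Y = ?B * E" unfolding E_def using C Y B by (metis assoc_mult_mat)
  have "?B * (E * ?B) = A * Y * ?B" unfolding AY by (rule assoc_mult_mat[OF B E B, symmetric])
  also have "\<dots> = A * Y * A * D" using A Y D by (metis assoc_mult_mat mult_carrier_mat)
  also have "\<dots> = ?B" using AYA D by simp
  finally have BEB: "?B * (E * ?B) = ?B" .
  let ?M = "E * ?B - 1\<^sub>m ?k"
  have M: "?M \<in> carrier_mat ?k ?k" by (rule minus_carrier_mat[OF one_carrier_mat])
  have BM: "?B * ?M = 0\<^sub>m n ?k"
    unfolding mult_minus_distrib_mat[OF B mult_carrier_mat[OF E B] one_carrier_mat] BEB
    by (simp add: minus_r_inv_mat[OF B])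
  have "?M = 0\<^sub>m ?k ?k"
  proof (rule eq_matI)
    fix i j assume "i < dim_row (0\<^sub>m ?k ?k)" "j < dim_col (0\<^sub>m ?k ?k)"
    then have ij: "i < ?k" "j < ?k" by auto
    have "?B *\<^sub>v col ?M j = col (?B * ?M) j" using ij M B by (intro eq_vecI) auto
    also have "\<dots> = 0\<^sub>v n" unfolding BM using ij by (intro eq_vecI) auto
    finally have "?B *\<^sub>v col ?M j = 0\<^sub>v n" .
    moreover have "col ?M j \<in> carrier_vec ?k" by (rule carrier_vecI) simp
    ultimately have "col ?M j = 0\<^sub>v ?k" using basis unfolding right_basis_def by blast
    then have "col ?M j $ i = 0" using ij by simp
    moreover have "col ?M j $ i = ?M $$ (i, j)" using ij M E by (intro index_col) auto
    ultimately show "?M $$ (i, j) = 0\<^sub>m ?k ?k $$ (i, j)" using ij by simp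
  qed (use E in auto)
  then have "re_trace (E * ?B) - re_trace (1\<^sub>m ?k) = 0"
    using re_trace_minus[of "E * ?B" ?k "1\<^sub>m ?k"] E B by simp
  then have "re_trace (E * ?B) = real ?k" by simp
  then show ?thesis unfolding AY re_trace_mult_commute[OF B E] by simp
qed

text \<open>One real trace gives the length of every basis, so the description in
  \<open>right_dim\<close> has a unique witness.\<close>

lemma quat_rank_eq_re_trace:
  assumes A: "A \<in> carrier_mat n m" and Y: "Y \<in> carrier_mat m n" and AYA: "A * Y * A = A"
  shows "real (quat_rank A) = re_trace (A * Y)"
proof -
  obtain bs where bs: "right_basis n (right_col_space A) bs" using right_basis_exists[OF A] ..
  note len = length_right_basis[OF A Y AYA]
  have "right_dim n (right_col_space A) = length bs"
    unfolding right_dim_def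
  proof (rule the_equality)
    show "\<exists>bs'. right_basis n (right_col_space A) bs' \<and> length bs' = length bs" using bs by blast
    fix k assume "\<exists>bs'. right_basis n (right_col_space A) bs' \<and> length bs' = k"
    then obtain bs' where "right_basis n (right_col_space A) bs'" "length bs' = k" by blast
    then show "k = length bs" using len[OF bs] len by (metis of_nat_eq_iff)
  qed
  then show ?thesis using len[OF bs] A by (simp add: quat_rank_def)
qed

subsection \<open>The Moore-Penrose inverse as a generalized adjugate\<close>

text \<open>The recursion is that of Faddeev and Leverrier.\<close>

lemma leverrier_projection:
  fixes H :: "quat mat" and G :: "nat \<Rightarrow> quat mat" and d :: "nat \<Rightarrow> real"
  assumes H: "H \<in> carrier_mat n n" "conj_transpose H = H"
    and G: "\<And>s. G s \<in> carrier_mat n n" "G 0 = 0\<^sub>m n n" "\<And>s. n < s \<Longrightarrow> G s = 0\<^sub>m n n"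
    and d: "d 0 \<noteq> 0" "\<And>s. n < s \<Longrightarrow> d s = 0"
    and rec: "\<And>s. H * G s + G (Suc s) = of_real (d s) \<cdot>\<^sub>m 1\<^sub>m n"
    and trace: "\<And>s. re_trace (H * G s) = real s * d s"
  obtains r N where "d r \<noteq> 0" "N = of_real (1 / d r) \<cdot>\<^sub>m G r" "conj_transpose N = N"
    "N * H = H * N" "H * N * H = H" "re_trace (H * N) = real r"
proof -
  note sq = assoc_mult_mat[of _ n n _ n _ n] mult_carrier_mat[of _ n n _ n]
  have one: "X * (of_real c \<cdot>\<^sub>m 1\<^sub>m n) = of_real c \<cdot>\<^sub>m X" "(of_real c \<cdot>\<^sub>m 1\<^sub>m n) * X = of_real c \<cdot>\<^sub>m X"
    if "X \<in> carrier_mat n n" for X :: "quat mat" and c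
    using that by (simp_all add: mult_smult_of_real[of X n n "1\<^sub>m n" n] smult_of_real_mult[of "1\<^sub>m n" n n X n])
  have G_Suc: "G (Suc s) = of_real (d s) \<cdot>\<^sub>m 1\<^sub>m n - H * G s" for s
  proof (rule eq_matI)
    fix i j assume "i < dim_row (of_real (d s) \<cdot>\<^sub>m 1\<^sub>m n - H * G s)" "j < dim_col (of_real (d s) \<cdot>\<^sub>m 1\<^sub>m n - H * G s)"
    then have ij: "i < n" "j < n" using H G(1)[of s] by auto
    have "(H * G s + G (Suc s)) $$ (i, j) = (of_real (d s) \<cdot>\<^sub>m 1\<^sub>m n) $$ (i, j)" unfolding rec ..
    moreover have "(H * G s + G (Suc s)) $$ (i, j) = (H * G s) $$ (i, j) + G (Suc s) $$ (i, j)"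
      using ij G(1)[of "Suc s"] by (intro index_add_mat) auto
    moreover have "(of_real (d s) \<cdot>\<^sub>m 1\<^sub>m n - H * G s) $$ (i, j)
        = (of_real (d s) \<cdot>\<^sub>m 1\<^sub>m n) $$ (i, j) - (H * G s) $$ (i, j)"
      using ij H G(1)[of s] by (intro index_minus_mat) auto
    ultimately show "G (Suc s) $$ (i, j) = (of_real (d s) \<cdot>\<^sub>m 1\<^sub>m n - H * G s) $$ (i, j)"
      by (metis add_diff_cancel_left')
  qed (use H G(1)[of s] G(1)[of "Suc s"] in auto)
  have HG: "H * G s \<in> carrier_mat n n" "G s * H \<in> carrier_mat n n" for s
    using H G(1)[of s] by (auto simp: sq)
  have scal: "of_real (c :: real) \<cdot>\<^sub>m (1\<^sub>m n :: quat mat) \<in> carrier_mat n n" for c by simp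
  have comm: "G s * H = H * G s" for s
  proof (induct s)
    case (Suc s)
    have "H * (H * G s) = H * G s * H" using H G(1)[of s] Suc by (simp add: sq)
    then show ?case
      unfolding G_Suc minus_mult_distrib_mat[OF scal HG(1) H(1)] mult_minus_distrib_mat[OF H(1) scal HG(1)]
      using H(1) by (simp add: one)
  qed (use H G in simp)
  have herm: "conj_transpose (G s) = G s" for s
  proof (induct s)
    case (Suc s)
    have "conj_transpose (H * G s) = H * G s"
      unfolding conj_transpose_mult[OF H(1) G(1)] Suc H(2) by (rule comm)
    then show ?case
      unfolding G_Suc conj_transpose_minus[OF scal HG(1)] by (simp add: conj_transpose_smult_of_real)
  qed (simp add: G(2), auto intro!: eq_matI)
  define r where "r = Max {s. d s \<noteq> 0}"
  have fin: "finite {s. d s \<noteq> 0}"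
    by (rule finite_subset[of _ "{..n}"]) (use d(2) in \<open>auto simp: not_less[symmetric]\<close>)
  have r: "d r \<noteq> 0" using Max_in[OF fin] d(1) unfolding r_def by auto
  have above: "d s = 0" if "r < s" for s
    using Max_ge[OF fin, of s] that unfolding r_def by (metis leD mem_Collect_eq)
  \<comment> \<open>Downward induction from \<open>n + 1\<close>. Once \<open>d s = 0\<close> and
    \<open>H * G (Suc s) = 0\<close>, the recursion leaves \<open>H * (H * G s) = 0\<close>. As
    \<open>H\<close> is Hermitian, \<open>H * H\<close> is a Gram matrix, and one factor
    \<open>H\<close> can be cancelled.\<close>
  have vanish: "H * G s = 0\<^sub>m n n" if "r < s" for s
  proof (cases "n < s")
    case True then show ?thesis using G(3) H by simp
  next
    case False
    then have "s \<le> Suc n" by simp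
    then show ?thesis using that
    proof (induct s rule: inc_induct)
      case base
      then show ?case using G(3)[of "Suc n"] H by simp
    next
      case (step s)
      have z: "of_real (d s) \<cdot>\<^sub>m (1\<^sub>m n :: quat mat) = 0\<^sub>m n n"
        using above[of s] step.prems by (intro eq_matI) auto
      have "0\<^sub>m n n = H * G (Suc s)" using step by simp
      also have "\<dots> = H * (0\<^sub>m n n - H * G s)" unfolding G_Suc z ..
      also have "\<dots> = 0\<^sub>m n n - H * (H * G s)"
        unfolding mult_minus_distrib_mat[OF H(1) zero_carrier_mat HG(1)] using H by simp
      finally have "0\<^sub>m n n = H * (H * G s)"
        using mult_carrier_mat[OF H(1) HG(1)[of s]] by (intro minus_mat_eq_0[OF zero_carrier_mat]) auto
      then have "G s * (H * conj_transpose H) = 0\<^sub>m n n"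
        unfolding H(2) using H(1) G(1)[of s] comm[of s] by (simp add: sq flip: assoc_mult_mat[of "G s" n n H n H n])
      then have "G s * H = 0\<^sub>m n n" by (rule mult_gram_eq_0[OF G(1) H(1)])
      then show ?case by (simp only: comm)
    qed
  qed
  define N where "N = of_real (1 / d r) \<cdot>\<^sub>m G r"
  have HN: "H * N = of_real (1 / d r) \<cdot>\<^sub>m (H * G r)" "N * H = of_real (1 / d r) \<cdot>\<^sub>m (G r * H)"
    unfolding N_def by (rule mult_smult_of_real[OF H(1) G(1)] smult_of_real_mult[OF G(1) H(1)])+
  have Nc: "N \<in> carrier_mat n n" using G(1)[of r] by (simp add: N_def)
  \<comment> \<open>At \<open>s = r\<close> the recursion, multiplied by \<open>H\<close>, says that
    \<open>H * H * G r\<close> is \<open>d r\<close> times \<open>H\<close>; after division by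
    \<open>d r\<close> this is \<open>H * N * H = H\<close>.\<close>
  have "0\<^sub>m n n = H * G (Suc r)" using vanish[of "Suc r"] by simp
  also have "\<dots> = of_real (d r) \<cdot>\<^sub>m H - H * (H * G r)"
    unfolding G_Suc mult_minus_distrib_mat[OF H(1) scal HG(1)] using H(1) by (simp add: one)
  finally have HHG: "of_real (d r) \<cdot>\<^sub>m H = H * (H * G r)"
    using mult_carrier_mat[OF H(1) HG(1)[of r]] H(1)
    by (intro minus_mat_eq_0[OF smult_carrier_mat]) auto
  have "H * N * H = H * (N * H)" using H(1) Nc by (simp add: sq)
  also have "\<dots> = of_real (1 / d r) \<cdot>\<^sub>m (H * (H * G r))"
    unfolding HN comm by (rule mult_smult_of_real[OF H(1) HG(1)])
  also have "\<dots> = H"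
  proof -
    have "of_real (1 / d r) * (of_real (d r) * x) = x" for x :: quat
    proof -
      have "of_real (1 / d r) * (of_real (d r) * x) = of_real (1 / d r * d r) * x"
        by (simp only: of_real_mult mult.assoc)
      then show ?thesis using r by simp
    qed
    then show ?thesis
      unfolding HHG[symmetric] by (intro eq_matI) (simp_all only: index_smult_mat)
  qed
  finally have HNH: "H * N * H = H" .
  show ?thesis
  proof (rule that[OF r N_def _ _ HNH])
    show "conj_transpose N = N" unfolding N_def conj_transpose_smult_of_real herm ..
    show "N * H = H * N" unfolding HN comm ..
    show "re_trace (H * N) = real r"
      unfolding HN re_trace_smult_of_real[OF HG(1)] trace using r by simp
  qed
qed

text \<open>Entries outside the matrix are unspecified; they are set to \<open>0\<close> so that the Hermitian symmetry
  holds for all indices.\<close>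

definition entries :: "nat \<Rightarrow> quat mat \<Rightarrow> nat \<Rightarrow> nat \<Rightarrow> quat" where
  "entries n M p q = (if p < n \<and> q < n then M $$ (p, q) else 0)"

lemma hermitian_entries_gram:
  assumes "A \<in> carrier_mat n n"
  shows "hermitian_entries (entries n (A * conj_transpose A))"
proof
  fix p q
  have "conj_transpose (A * conj_transpose A) = A * conj_transpose A"
    using assms by (simp add: conj_transpose_mult[of A n n _ n])
  then have "qcnj ((A * conj_transpose A) $$ (p, q)) = (A * conj_transpose A) $$ (q, p)" if "p < n" "q < n"
    using assms that conj_transpose_index[of q "A * conj_transpose A" p] by simp
  then show "qcnj (entries n (A * conj_transpose A) p q) = entries n (A * conj_transpose A) q p"
    by (auto simp: entries_def)
qed

section \<open>The generalized adjugate of a Gram matrix\<close>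

definition gram_adj :: "nat \<Rightarrow> quat mat \<Rightarrow> nat \<Rightarrow> quat mat" where
  "gram_adj n A s = mat n n (\<lambda>(q, j).
     hermitian_entries.gen_adj (entries n (A * conj_transpose A)) n s q j)"

definition gram_minor_sum :: "nat \<Rightarrow> quat mat \<Rightarrow> nat \<Rightarrow> real" where
  "gram_minor_sum n A s = hermitian_entries.minor_sum (entries n (A * conj_transpose A)) n s"

lemma gram_adj_carrier [simp]: "gram_adj n A s \<in> carrier_mat n n"
  by (simp add: gram_adj_def)

theorem moore_penrose_gram_adj:
  assumes A: "A \<in> carrier_mat n n"
  shows "gram_minor_sum n A (quat_rank A) \<noteq> 0"
    and "is_moore_penrose A
      (conj_transpose A * (of_real (1 / gram_minor_sum n A (quat_rank A)) \<cdot>\<^sub>m gram_adj n A (quat_rank A)))"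
proof -
  define h where "h = entries n (A * conj_transpose A)"
  define G where "G = gram_adj n A"
  define d where "d = gram_minor_sum n A"
  note G_def' = G_def gram_adj_def[of n A, folded h_def]
  note d_def' = d_def gram_minor_sum_def[of n A, folded h_def]
  interpret hermitian_entries h unfolding h_def by (rule hermitian_entries_gram[OF A])
  define H where "H = A * conj_transpose A"
  have H: "H \<in> carrier_mat n n" "conj_transpose H = H"
    using A by (auto simp: H_def conj_transpose_mult[of A n n _ n] mult_carrier_mat[of _ n n _ n])
  have h: "h p q = H $$ (p, q)" if "p < n" "q < n" for p q
    using that by (simp add: h_def H_def entries_def)
  have G: "G s \<in> carrier_mat n n" for s by (simp add: G_def')
  have HG: "(H * G s) $$ (k, j) = (\<Sum>q<n. h k q * gen_adj n s q j)" if "k < n" "j < n" for k j s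
    unfolding mult_mat_index_sum[OF H(1) G that]
    by (intro sum.cong refl) (use that in \<open>auto simp: h G_def'\<close>)
  have rec: "H * G s + G (Suc s) = of_real (d s) \<cdot>\<^sub>m 1\<^sub>m n" for s
  proof (rule eq_matI)
    fix k j assume "k < dim_row (of_real (d s) \<cdot>\<^sub>m 1\<^sub>m n :: quat mat)" "j < dim_col (of_real (d s) \<cdot>\<^sub>m 1\<^sub>m n :: quat mat)"
    then have kj: "k < n" "j < n" by auto
    have "(H * G s + G (Suc s)) $$ (k, j) = (H * G s) $$ (k, j) + G (Suc s) $$ (k, j)"
      using kj G[of "Suc s"] by (intro index_add_mat) auto
    also have "\<dots> = (\<Sum>q<n. h k q * gen_adj n s q j) + gen_adj n (Suc s) k j"
      unfolding HG[OF kj] using kj by (simp add: G_def')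
    also have "\<dots> = (of_real (d s) \<cdot>\<^sub>m 1\<^sub>m n) $$ (k, j)"
      unfolding gen_adj_rec[OF kj] using kj by (simp add: d_def')
    finally show "(H * G s + G (Suc s)) $$ (k, j) = (of_real (d s) \<cdot>\<^sub>m 1\<^sub>m n) $$ (k, j)" .
  qed (use G[of "Suc s"] in auto)
  have trace: "re_trace (H * G s) = real s * d s" for s
  proof -
    have "re_trace (H * G s) = (\<Sum>j<n. qRe ((H * G s) $$ (j, j)))"
      using H(1) by (simp add: re_trace_def del: index_mult_mat(1))
    also have "\<dots> = (\<Sum>j<n. qRe (\<Sum>q<n. h j q * gen_adj n s q j))"
      by (intro sum.cong refl) (simp add: HG del: index_mult_mat(1) qRe_sum)
    finally show ?thesis unfolding trace_gen_adj d_def' .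
  qed
  have "G 0 = 0\<^sub>m n n" "\<And>s. n < s \<Longrightarrow> G s = 0\<^sub>m n n"
    unfolding G_def' by (auto intro!: eq_matI simp: gen_adj_eq_0)
  moreover have "d 0 \<noteq> 0" "\<And>s. n < s \<Longrightarrow> d s = 0" by (auto simp: d_def' minor_sum_eq_0)
  ultimately obtain r N where N: "d r \<noteq> 0" "N = of_real (1 / d r) \<cdot>\<^sub>m G r" "conj_transpose N = N"
    "N * H = H * N" "H * N * H = H" "re_trace (H * N) = real r"
    using leverrier_projection[of H n G d] H G rec trace by metis
  have Nc: "N \<in> carrier_mat n n" using G[of r] N(2) by simp
  have mp: "is_moore_penrose A (conj_transpose A * N)"
    by (rule is_moore_penrose_gram[OF A Nc N(3) H_def N(4,5)])
  have Y: "conj_transpose A * N \<in> carrier_mat n n" using A Nc by (simp add: mult_carrier_mat[of _ n n _ n])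
  \<comment> \<open>This product with an inner inverse of \<open>A\<close> has the rank as its real
    trace, while the Leverrier recursion gave the trace \<open>r\<close>; so \<open>r\<close> is the
    rank.\<close>
  have "A * (conj_transpose A * N) = H * N"
    unfolding H_def using A Nc by (simp add: assoc_mult_mat[of _ n n _ n _ n])
  then have "real (quat_rank A) = real r"
    using quat_rank_eq_re_trace[OF A Y] mp N(6) by (simp add: is_moore_penrose_def)
  then have "quat_rank A = r" by simp
  then show "gram_minor_sum n A (quat_rank A) \<noteq> 0"
    and "is_moore_penrose A
      (conj_transpose A * (of_real (1 / gram_minor_sum n A (quat_rank A)) \<cdot>\<^sub>m gram_adj n A (quat_rank A)))"
    using N mp unfolding G_def d_def by auto
qed

lemma moore_penrose:
  assumes A: "A \<in> carrier_mat n n"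
  shows "moore_penrose A \<in> carrier_mat n n"
    and "A * (moore_penrose A * A) = A"
    and "conj_transpose (A * moore_penrose A) = A * moore_penrose A"
    and "conj_transpose (moore_penrose A * A) = moore_penrose A * A"
proof -
  have mp: "is_moore_penrose A (moore_penrose A)"
    using moore_penrose_gram_adj(2)[OF A] moore_penrose_eqI[OF A] by metis
  then show c: "moore_penrose A \<in> carrier_mat n n"
    and "conj_transpose (A * moore_penrose A) = A * moore_penrose A"
    and "conj_transpose (moore_penrose A * A) = moore_penrose A * A"
    using A by (auto simp: is_moore_penrose_def)
  show "A * (moore_penrose A * A) = A"
    using mp assoc_mult_mat[OF A c A] by (simp add: is_moore_penrose_def)
qed

lemma quat_rank_moore_penrose:
  assumes A: "A \<in> carrier_mat n n"
  shows "real (quat_rank A) = re_trace (A * moore_penrose A)"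
    and "real (quat_rank A) = re_trace (moore_penrose A * A)"
proof -
  note c = moore_penrose(1)[OF A]
  show 1: "real (quat_rank A) = re_trace (A * moore_penrose A)"
    by (rule quat_rank_eq_re_trace[OF A c]) (use moore_penrose(2)[OF A] assoc_mult_mat[OF A c A] in simp)
  then show "real (quat_rank A) = re_trace (moore_penrose A * A)"
    by (simp only: re_trace_mult_commute[OF A c])
qed

text \<open>By \<open>P * Q = Q\<close> and its conjugate, \<open>P - Q\<close> is a Hermitian
  idempotent, so it equals its own Gram matrix; with trace 0 it vanishes. Geometrically, nested
  spaces of equal dimension coincide.\<close>

lemma hermitian_idempotent_eqI:
  assumes P: "P \<in> carrier_mat n n" "conj_transpose P = P" "P * P = P"
    and Q: "Q \<in> carrier_mat n n" "conj_transpose Q = Q" "Q * Q = Q"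
    and PQ: "P * Q = Q" and tr: "re_trace P = re_trace Q"
  shows "P = Q"
proof -
  have QP: "Q * P = Q"
    using conj_transpose_mult[OF P(1) Q(1)] unfolding PQ P(2) Q(2) ..
  have c: "P - Q \<in> carrier_mat n n" using minus_carrier_mat[OF Q(1)] .
  have "(P - Q) * conj_transpose (P - Q) = (P - Q) * (P - Q)"
    unfolding conj_transpose_minus[OF P(1) Q(1)] P(2) Q(2) ..
  also have "\<dots> = P * (P - Q) - Q * (P - Q)" by (rule minus_mult_distrib_mat[OF P(1) Q(1) c])
  also have "P * (P - Q) = P - Q" unfolding mult_minus_distrib_mat[OF P(1) P(1) Q(1)] P(3) PQ ..
  also have "Q * (P - Q) = 0\<^sub>m n n"
    unfolding mult_minus_distrib_mat[OF Q(1) P(1) Q(1)] QP Q(3) by (rule minus_r_inv_mat[OF Q(1)])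
  also have "P - Q - 0\<^sub>m n n = P - Q" using P Q by (intro eq_matI) auto
  finally have "re_trace ((P - Q) * conj_transpose (P - Q)) = 0"
    using tr by (simp add: re_trace_minus[OF P(1) Q(1)])
  then show ?thesis
    using re_trace_mult_conj_transpose_eq_0[OF c] by (intro minus_mat_eq_0[OF P(1) Q(1)])
qed

subsection \<open>Matrices of index one and their core inverse\<close>

text \<open>Equal ranks force \<open>A\<close> and \<open>A * A\<close> to have the same orthogonal
  projections onto their column spaces and, by the mirrored argument, onto their row spaces. With
  \<open>K\<close> the Moore-Penrose inverse of \<open>A * A\<close>, this makes
  \<open>Q = K * A\<close> and \<open>T = A * K\<close> work.\<close>

lemma index_one_factors:
  assumes A: "A \<in> carrier_mat n n" and rk: "quat_rank (A * A) = quat_rank A"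
  obtains Q T where "Q \<in> carrier_mat n n" "T \<in> carrier_mat n n" "A * (A * Q) = A" "T * (A * A) = A"
proof -
  note sq = assoc_mult_mat[of _ n n _ n _ n] mult_carrier_mat[of _ n n _ n]
  have A2: "A * A \<in> carrier_mat n n" using A by (simp add: sq)
  let ?M = "moore_penrose A" let ?K = "moore_penrose (A * A)"
  note M = moore_penrose[OF A] and K = moore_penrose[OF A2]
  have AM: "A * (?M * (A * X)) = A * X" if "X \<in> carrier_mat n n" for X
    using arg_cong[OF M(2), of "\<lambda>Z. Z * X"] A M(1) that by (simp add: sq)
  have KA: "A * (A * (?K * (A * (A * X)))) = A * (A * X)" if "X \<in> carrier_mat n n" for X
    using arg_cong[OF K(2), of "\<lambda>Z. Z * X"] A K(1) that by (simp add: sq)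
  have eq: "A * ?M = A * A * ?K"
  proof (rule hermitian_idempotent_eqI[where n = n])
    show "re_trace (A * ?M) = re_trace (A * A * ?K)"
      using quat_rank_moore_penrose(1)[OF A] quat_rank_moore_penrose(1)[OF A2] rk by simp
  qed (use A M(1,3) K(1,3) AM KA in \<open>simp_all add: sq\<close>)
  have 1: "A * (A * (?K * A)) = A"
    using arg_cong[OF eq, of "\<lambda>Z. Z * A"] M(2) A M(1) K(1) by (simp add: sq)
  have herm: "conj_transpose (?K * (A * A) * (?M * A)) = ?M * A * (?K * (A * A))"
    using conj_transpose_mult[of "?K * (A * A)" n n "?M * A" n] A M K by (simp add: sq)
  have "?K * (A * A) * (?M * A) = ?K * (A * A)" using A M(1,2) K(1) by (simp add: sq)
  then have MK: "?M * A * (?K * (A * A)) = ?K * (A * A)" using herm K(4) by simp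
  have "?M * A = ?K * (A * A)"
  proof (rule hermitian_idempotent_eqI[where n = n])
    show "re_trace (?M * A) = re_trace (?K * (A * A))"
      using quat_rank_moore_penrose(2)[OF A] quat_rank_moore_penrose(2)[OF A2] rk by simp
    show "?M * A * (?K * (A * A)) = ?K * (A * A)" by (rule MK)
    show "?K * (A * A) * (?K * (A * A)) = ?K * (A * A)"
      using K(2) A K(1) by (simp add: sq)
    show "?M * A * (?M * A) = ?M * A" using A M(1,2) by (simp add: sq)
    show "conj_transpose (?M * A) = ?M * A" by (rule M(4))
    show "conj_transpose (?K * (A * A)) = ?K * (A * A)" by (rule K(4))
  qed (use A M(1) K(1) in \<open>simp_all add: sq\<close>)
  then have "A * (?K * (A * A)) = A" using M(2) by simp
  then have 2: "A * ?K * (A * A) = A" using A K(1) by (simp add: sq)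
  show ?thesis
    by (rule that[OF _ _ 1 2]) (use A K(1) in \<open>simp_all add: sq\<close>)
qed

theorem right_core_inverse_eq:
  assumes A: "A \<in> carrier_mat n n" and rk: "quat_rank (A * A) = quat_rank A"
  shows "right_core_inverse A = A * (moore_penrose (A * (A * A)) * (A * (A * moore_penrose A)))"
    and "quat_rank (A * (A * A)) = quat_rank A"
proof -
  note sq = assoc_mult_mat[of _ n n _ n _ n] mult_carrier_mat[of _ n n _ n]
  obtain Q T where QT: "Q \<in> carrier_mat n n" "T \<in> carrier_mat n n" "A * (A * Q) = A" "T * (A * A) = A"
    using index_one_factors[OF A rk] .
  have A3: "A * (A * A) \<in> carrier_mat n n" using A by (simp add: sq)
  let ?M = "moore_penrose A" let ?K = "moore_penrose (A * (A * A))"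
  note M = moore_penrose[OF A] and K = moore_penrose[OF A3]
  have AM: "A * (?M * (A * X)) = A * X" if "X \<in> carrier_mat n n" for X
    using arg_cong[OF M(2), of "\<lambda>Z. Z * X"] A M(1) that by (simp add: sq)
  have AK: "A * (A * (A * (?K * (A * (A * (A * X)))))) = A * (A * (A * X))" if "X \<in> carrier_mat n n" for X
    using arg_cong[OF K(2), of "\<lambda>Z. Z * X"] A K(1) that by (simp add: sq)
  have Q: "A * (A * (Q * X)) = A * X" if "X \<in> carrier_mat n n" for X
    using arg_cong[OF QT(3), of "\<lambda>Z. Z * X"] A QT(1) that by (simp add: sq)
  have T: "T * (A * (A * X)) = A * X" if "X \<in> carrier_mat n n" for X
    using arg_cong[OF QT(4), of "\<lambda>Z. Z * X"] A QT(2) that by (simp add: sq)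
  have A3Q: "A * (A * (A * (Q * (Q * X)))) = A * X" if "X \<in> carrier_mat n n" for X
    using Q[of "Q * X"] Q[OF that] QT(1) that by (simp add: sq)
  let ?P = "A * ?M" and ?R = "A * (A * A) * ?K"
  \<comment> \<open>The columns of \<open>?P\<close> lie in the column space of the cube, as
    \<open>A3Q\<close> writes \<open>A\<close> as the cube times \<open>Q * Q\<close>; and
    \<open>?R\<close> fixes that space.\<close>
  have RP: "?R * ?P = ?P"
    using AK[of "Q * (Q * ?M)"] A3Q[OF M(1)] A M(1) K(1) QT(1) by (simp add: sq)
  have "conj_transpose (?R * ?P) = ?P * ?R"
    unfolding conj_transpose_mult[OF mult_carrier_mat[OF A3 K(1)] mult_carrier_mat[OF A M(1)]] M(3) K(3) ..
  then have "?P * ?R = ?P" unfolding RP M(3) ..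
  moreover have "?P * ?R = ?R" using AM A M(1) K(1) by (simp add: sq)
  ultimately have "?P = ?R" by simp
  then show "quat_rank (A * (A * A)) = quat_rank A"
    using quat_rank_moore_penrose(1)[OF A] quat_rank_moore_penrose(1)[OF A3] by simp
  define Y where "Y = ?K * (A * (A * ?M))"
  have Y: "Y \<in> carrier_mat n n" using A M(1) K(1) by (simp add: Y_def sq)
  \<comment> \<open>\<open>T\<close> on the left and \<open>Q\<close> on the right each strip one
    factor \<open>A\<close> from both cubes in the inner-inverse equation of
    \<open>?K\<close>.\<close>
  have AKA: "A * (A * (?K * (A * (A * X)))) = A * X" if X: "X \<in> carrier_mat n n" for X
  proof -
    have "A * (A * (?K * (A * (A * X)))) = T * (A * (A * (A * (?K * (A * (A * (A * (Q * X))))))))"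
      using T[of "A * (?K * (A * (A * X)))"] Q[OF X] A K(1) X by (simp add: sq)
    also have "\<dots> = T * (A * (A * X))"
      using AK[of "Q * X"] Q[OF X] X QT(1) A by (simp add: sq)
    finally show ?thesis using T[OF X] by simp
  qed
  have core: "is_right_core_inverse A (A * Y)"
    unfolding is_right_core_inverse_def
  proof (intro conjI)
    show "A * Y \<in> carrier_mat (dim_row A) (dim_row A)" using A Y by (simp add: sq)
    show "A * (A * Y) = A * ?M" unfolding Y_def by (rule AKA[OF M(1)])
    \<comment> \<open>\<open>A * Y * (A * A)\<close> reduces to \<open>A * ?K\<close> times the
      cube. Two applications of \<open>T\<close> introduce a full cube on the left, so that the
      inner-inverse equation of \<open>?K\<close> applies.\<close>
    have "A * (?K * (A * (A * A))) = T * (T * (A * (A * (A * (?K * (A * (A * A)))))))"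
      using T[of "?K * (A * (A * A))"] T[of "A * (?K * (A * (A * A)))"] A K(1) by (simp add: sq)
    also have "\<dots> = A" using K(2) T[OF A] QT(4) A K(1) by (simp add: sq)
    finally have "A = A * Y * (A * A)"
      unfolding Y_def using A M K(1) AM by (simp add: sq)
    moreover have "A * A \<in> carrier_mat n n" using A by (simp add: sq)
    moreover have AY': "A * Y \<in> carrier_mat n n" by (rule mult_carrier_mat[OF A Y])
    ultimately have "right_col_space A \<subseteq> right_col_space (A * Y)"
      unfolding right_col_space_subset_iff[OF A AY'] by blast
    moreover have "right_col_space (A * Y) \<subseteq> right_col_space A"
      unfolding right_col_space_subset_iff[OF AY' A] using Y by blast
    ultimately show "right_col_space (A * Y) = right_col_space A" by simp
  qed
  \<comment> \<open>A candidate has the form \<open>A * Z\<close>, and \<open>T\<close> recovers it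
    from the prescribed product \<open>A * (A * Z)\<close>.\<close>
  have unique: "X = A * Y" if X: "is_right_core_inverse A X" for X
  proof -
    have "X \<in> carrier_mat n n" "A * X = A * ?M" "right_col_space X = right_col_space A"
      using X A by (auto simp: is_right_core_inverse_def)
    then obtain Z where Z: "Z \<in> carrier_mat n n" "X = A * Z"
      using A right_col_space_subset_iff[of X n n A n] by auto
    have "A * (A * Z) = A * (A * Y)"
      using \<open>A * X = A * ?M\<close> core unfolding Z(2) is_right_core_inverse_def by simp
    then have "T * (A * (A * Z)) = T * (A * (A * Y))" by simp
    then show ?thesis unfolding Z(2) T[OF Z(1)] T[OF Y] .
  qed
  show "right_core_inverse A = A * (?K * (A * (A * ?M)))"
    unfolding right_core_inverse_def Y_def[symmetric]
    by (rule the_equality, rule core, rule unique)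
qed

subsection \<open>The determinantal representation\<close>

lemma sum_rdet_replace_row:
  assumes A: "A \<in> carrier_mat n n" and j: "j < n"
  shows "(\<Sum>\<alpha>\<in>index_sets_at s n j. rdet \<alpha> j (replace_row (A * conj_transpose A) j b))
    = (\<Sum>q<n. b $ q * gram_adj n A s $$ (q, j))"
proof -
  let ?H = "A * conj_transpose A" let ?h = "entries n ?H"
  interpret hermitian_entries ?h by (rule hermitian_entries_gram[OF A])
  have "(\<Sum>\<alpha>\<in>index_sets_at s n j. rdet \<alpha> j (replace_row ?H j b))
    = (\<Sum>\<alpha>\<in>index_sets_at s n j. rowdet \<alpha> j (?h(j := (\<lambda>q. b $ q))))"
  proof (rule sum.cong[OF refl])
    fix \<alpha> assume "\<alpha> \<in> index_sets_at s n j"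
    then have a: "\<alpha> \<subseteq> {..<n}" "j \<in> \<alpha>" by (auto simp: index_sets_at_def index_sets_def)
    show "rdet \<alpha> j (replace_row ?H j b) = rowdet \<alpha> j (?h(j := (\<lambda>q. b $ q)))"
      unfolding rdet_conv_rowdet
    proof (rule rowdet_cong)
      fix p q assume "p \<in> \<alpha>" "q \<in> \<alpha>"
      then have "p < n" "q < n" using a by auto
      then show "replace_row ?H j b $$ (p, q) = (?h(j := (\<lambda>q. b $ q))) p q"
        using A by (simp add: replace_row_def entries_def del: index_mult_mat(1))
    next
      show "finite \<alpha>" using a(1) finite_subset by blast
      show "j \<in> \<alpha>" by (rule a(2))
    qed
  qed
  also have "\<dots> = (\<Sum>q<n. b $ q * gen_adj n s q j)" by (rule sum_rowdet_linear)
  finally show ?thesis using j by (simp add: gram_adj_def)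
qed

text \<open>For \<open>s = 0\<close> the only index set is empty; there \<open>herm_minor\<close> is
  unspecified, whereas \<open>gram_minor_sum\<close> is 1.\<close>

lemma sum_herm_minor:
  assumes A: "A \<in> carrier_mat n n" and s: "s \<noteq> 0"
  shows "(\<Sum>\<alpha>\<in>index_sets s n. herm_minor (A * conj_transpose A) \<alpha>) = gram_minor_sum n A s"
proof -
  let ?H = "A * conj_transpose A" let ?h = "entries n ?H"
  interpret hermitian_entries ?h by (rule hermitian_entries_gram[OF A])
  show ?thesis
    unfolding gram_minor_sum_def minor_sum_def
  proof (rule sum.cong[OF refl])
    fix \<alpha> assume a: "\<alpha> \<in> index_sets s n"
    show "herm_minor ?H \<alpha> = qRe (restdet \<alpha> ?h)"
    proof (intro herm_minor_eq)
      show "finite \<alpha>" using a by (rule finite_in_index_sets)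
      show "\<alpha> \<noteq> {}" using a s by (auto simp: index_sets_def)
      show "?H $$ (p, q) = ?h p q" if "p \<in> \<alpha>" "q \<in> \<alpha>" for p q
        using a that unfolding index_sets_def entries_def by auto
    qed
  qed
qed

theorem theorem3p5:
  fixes A U V :: "quat mat" and n s :: nat
  assumes "A \<in> carrier_mat n n"
    and "quat_rank (A ^\<^sub>m 2) = s" and "quat_rank A = s"
    and "moore_penrose A * A \<noteq> A * moore_penrose A"
    and U: "U = mat n n (\<lambda>(i, f). \<Sum>\<alpha> \<in> index_sets_at s n f.
          rdet \<alpha> f (replace_row (A ^\<^sub>m 3 * conj_transpose (A ^\<^sub>m 3)) f
                       (row (A * conj_transpose (A ^\<^sub>m 3)) i)))"
    and V: "V = U * A ^\<^sub>m 2 * conj_transpose A"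
  shows "\<forall>i < n. \<forall>j < n.
    right_core_inverse A $$ (i, j) =
      (\<Sum>\<alpha> \<in> index_sets_at s n j.
          rdet \<alpha> j (replace_row (A * conj_transpose A) j (row V i)))
      / of_real
          ((\<Sum>\<alpha> \<in> index_sets s n. herm_minor (A ^\<^sub>m 3 * conj_transpose (A ^\<^sub>m 3)) \<alpha>)
           * (\<Sum>\<alpha> \<in> index_sets s n. herm_minor (A * conj_transpose A) \<alpha>))"
proof (intro allI impI)
  note A = assms(1)
  note sq = assoc_mult_mat[of _ n n _ n _ n] mult_carrier_mat[of _ n n _ n]
  define C where "C = A * (A * A)"
  have C: "C \<in> carrier_mat n n" using A by (simp add: C_def sq)
  have pow: "A ^\<^sub>m 2 = A * A" "A ^\<^sub>m 3 = C"
    using A by (simp_all add: numeral_2_eq_2 numeral_3_eq_3 C_def sq)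
  have rk: "quat_rank (A * A) = quat_rank A" using assms(2,3) by (simp add: pow)
  define d1 d3 where "d1 = gram_minor_sum n A s" and "d3 = gram_minor_sum n C s"
  define G1 G3 where "G1 = gram_adj n A s" and "G3 = gram_adj n C s"
  have G: "G1 \<in> carrier_mat n n" "G3 \<in> carrier_mat n n" by (simp_all add: G1_def G3_def)
  define c1 c3 where "c1 = 1 / d1" and "c3 = 1 / d3"
  have mp: "moore_penrose A = conj_transpose A * (of_real c1 \<cdot>\<^sub>m G1)"
    using moore_penrose_eqI[OF A moore_penrose_gram_adj(2)[OF A]] assms(3) by (simp only: c1_def d1_def G1_def)
  have mp3: "moore_penrose C = conj_transpose C * (of_real c3 \<cdot>\<^sub>m G3)"
    using moore_penrose_eqI[OF C moore_penrose_gram_adj(2)[OF C]] right_core_inverse_eq(2)[OF A rk] assms(3)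
    by (simp only: c3_def d3_def G3_def C_def)
  \<comment> \<open>For rank 0 the Moore-Penrose inverse vanishes and commutes with
    \<open>A\<close>, which the fourth assumption excludes.\<close>
  have s: "s \<noteq> 0"
  proof
    assume "s = 0"
    then have "G1 = 0\<^sub>m n n"
      by (intro eq_matI) (auto simp: G1_def gram_adj_def hermitian_entries.gen_adj_0[OF hermitian_entries_gram[OF A]])
    then have "moore_penrose A = 0\<^sub>m n n"
      using A unfolding mp by (intro eq_matI) auto
    then show False using assms(4) A by simp
  qed
  have sums: "(\<Sum>\<alpha>\<in>index_sets s n. herm_minor (A * conj_transpose A) \<alpha>) = d1"
    "(\<Sum>\<alpha>\<in>index_sets s n. herm_minor (C * conj_transpose C) \<alpha>) = d3"
    unfolding d1_def d3_def using sum_herm_minor[OF _ s] A C by blast+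
  have row_mult: "(\<Sum>\<alpha>\<in>index_sets_at s n j. rdet \<alpha> j (replace_row (B * conj_transpose B) j (row M i)))
      = (M * gram_adj n B s) $$ (i, j)"
    if "B \<in> carrier_mat n n" "M \<in> carrier_mat n n" "i < n" "j < n" for B M i j
    unfolding sum_rdet_replace_row[OF that(1,4)] mult_mat_index_sum[OF that(2) gram_adj_carrier that(3,4)]
    using that by (intro sum.cong refl) auto
  have AC: "A * conj_transpose C \<in> carrier_mat n n" using A C by (simp add: sq)
  \<comment> \<open>Each numerator is linear in the substituted row, so letting that row run through
    the rows of a matrix amounts to multiplying the matrix by the generalized adjugate.\<close>
  have U': "U = A * conj_transpose C * G3"
    unfolding U pow
  proof (rule eq_matI)
    fix i f assume "i < dim_row (A * conj_transpose C * G3)" "f < dim_col (A * conj_transpose C * G3)"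
    then have "i < n" "f < n" using A G by auto
    then show "mat n n (\<lambda>(i, f). \<Sum>\<alpha>\<in>index_sets_at s n f.
        rdet \<alpha> f (replace_row (C * conj_transpose C) f (row (A * conj_transpose C) i))) $$ (i, f)
      = (A * conj_transpose C * G3) $$ (i, f)"
      using row_mult[OF C AC] by (simp add: G3_def del: index_mult_mat(1))
  qed (use A G in auto)
  have Uc: "U \<in> carrier_mat n n" by (simp add: U)
  have Vc: "V \<in> carrier_mat n n" using A Uc by (simp add: V pow sq)
  have "right_core_inverse A = A * (moore_penrose C * (A * (A * moore_penrose A)))"
    unfolding C_def by (rule right_core_inverse_eq(1)[OF A rk])
  \<comment> \<open>\<open>V * G1\<close> reads \<open>A * (conj_transpose C * G3) * (A * A) *
    (conj_transpose A * G1)\<close>: the two brackets are the Moore-Penrose inverses up to real,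
    hence central, factors.\<close>
  also have "\<dots> = of_real c1 \<cdot>\<^sub>m (of_real c3 \<cdot>\<^sub>m (V * G1))"
    unfolding mp mp3 V pow U' using A C G
    by (simp add: sq mult_smult_of_real[of _ n n _ n] smult_of_real_mult[of _ n n _ n])
  finally have eq: "right_core_inverse A = of_real c1 \<cdot>\<^sub>m (of_real c3 \<cdot>\<^sub>m (V * G1))" .
  fix i j assume ij: "i < n" "j < n"
  have VG: "V * G1 \<in> carrier_mat n n" by (rule mult_carrier_mat[OF Vc G(1)])
  have "right_core_inverse A $$ (i, j) = of_real c1 * (of_real c3 * (V * G1) $$ (i, j))"
  proof -
    have "i < dim_row (V * G1)" "j < dim_col (V * G1)" using carrier_matD[OF VG] ij by simp_all
    then show ?thesis unfolding eq by (simp only: index_smult_mat)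
  qed
  also have "\<dots> = (V * G1) $$ (i, j) / of_real (d3 * d1)"
  proof -
    have "c1 * c3 = inverse (d3 * d1)" by (simp add: c1_def c3_def field_simps)
    then have "inverse (of_real (d3 * d1)) = (of_real (c1 * c3) :: quat)" by (simp only: of_real_inverse)
    moreover have "of_real c1 * (of_real c3 * x) = x * of_real (c1 * c3)" for x :: quat
      using of_real_mult_commute[of "c1 * c3" x] by (simp add: mult.assoc)
    ultimately show ?thesis by (simp only: divide_inverse)
  qed
  finally show "right_core_inverse A $$ (i, j) =
      (\<Sum>\<alpha> \<in> index_sets_at s n j. rdet \<alpha> j (replace_row (A * conj_transpose A) j (row V i)))
      / of_real
          ((\<Sum>\<alpha> \<in> index_sets s n. herm_minor (A ^\<^sub>m 3 * conj_transpose (A ^\<^sub>m 3)) \<alpha>)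
           * (\<Sum>\<alpha> \<in> index_sets s n. herm_minor (A * conj_transpose A) \<alpha>))"
    unfolding pow sums row_mult[OF A Vc ij] G1_def .
qed

end
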